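(* Let $A\in\mathbb{R}^{d\times d}$ be symmetric positive definite with all eigenvalues in $[\mu,L]$, $0<\mu\le L$, and let $x^*\in\mathbb{R}^d$. Let $(x_k)$ be generated by the zeroth-order gradient descent method zoGD (described in the context) with no deterministic noise ($\Delta=0$), random noise level $\sigma$, constant step size $\gamma_k=\gamma$ with $0<\gamma\le\frac{1}{5dL}$, and $\tau_k>0$ with $\tau_k\ge\sqrt{\frac{2d\sigma^2}{\mu L}}$ for all $k$. Then for every $K\ge1$ $$\mathbb{E}\left[\|x_{K+1}-x^*\|^2\right]\le\left(1-\frac{\gamma\mu}{2}\right)^K\|x_1-x^*\|^2+\frac{10d^2\gamma\sigma^2}{\mu}.$$ Additionally, if $\sigma>0$ and $$\gamma=\min\left\{\frac{1}{5dL};\ \frac{2\ln\left(\max\left\{2;\ \frac{\mu^2\|x_1-x^*\|^2K}{20d^2\sigma^2}\right\}\right)}{\mu K}\right\},$$ then $$\mathbb{E}\left[\|x_{K+1}-x^*\|^2\right]\le\tilde{\mathcal{O}}\left(\exp\left(-\frac{\mu K}{20dL}\right)\|x_1-x^*\|^2+\frac{20d^2\sigma^2}{\mu^2K}\right),$$ where $\tilde{\mathcal{O}}$ hides an absolute constant and a factor $\ln\left(\max\left\{2;\frac{\mu^2\|x_1-x^*\|^2K}{20d^2\sigma^2}\right\}\right)$ on the second term.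
   Context: $\|\cdot\|$ is the Euclidean norm. The goal is to minimize $\frac12(x-x^* )^TA(x-x^* )$ over $\mathbb{R}^d$ using only the noisy zeroth-order oracle (with no deterministic noise) $$f(x,\xi)=\frac12(x-x^* )^TA(x-x^* )+\xi\,\|x-x^*\|,$$ where $\xi$ is a real random variable, not depending on $x$, with $\mathbb{E}\xi=0$ and $\mathbb{E}\xi^2\le\sigma^2$. Gradient estimator: for $e$ on the unit Euclidean sphere and $\tau>0$, $$g(x,\xi^{\pm},\tau,e)=\frac{d}{2\tau}\left(f(x+\tau e,\xi^+)-f(x-\tau e,\xi^-)\right)e .$$ Method zoGD: from a (deterministic) starting point $x_1\in\mathbb{R}^d$, for $k=1,\dots,K$ generate $e_k$ uniformly distributed on the unit Euclidean sphere of $\mathbb{R}^d$ and noise variables $\xi_k^+,\xi_k^-$ (each with zero mean and second moment at most $\sigma^2$), with $e_k,\xi^+_k,\xi^-_k$ independent of each other and of everything generated at previous iterations, and set $$x_{k+1}=x_k-\gamma_k\,g(x_k,\xi_k^{\pm},\tau_k,e_k).$$ The step sizes $\gamma_k$ and parameters $\tau_k$ are deterministic. *)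

theory Defs
  imports "HOL-Probability.Probability"
begin

definition eigenvalue :: "real^'n^'n \<Rightarrow> real \<Rightarrow> bool" where
  "eigenvalue A l \<longleftrightarrow> (\<exists>v. v \<noteq> 0 \<and> A *v v = l *\<^sub>R v)"

definition positive_definite :: "real^'n^'n \<Rightarrow> bool" where
  "positive_definite A \<longleftrightarrow> (\<forall>v. v \<noteq> 0 \<longrightarrow> 0 < v \<bullet> (A *v v))"

definition noisy_oracle :: "real^'n^'n \<Rightarrow> real^'n \<Rightarrow> real^'n \<Rightarrow> real \<Rightarrow> real" where
  "noisy_oracle A xs x \<xi> = 1/2 * ((x - xs) \<bullet> (A *v (x - xs))) + \<xi> * norm (x - xs)"

definition grad_estimate ::
    "(real^'n \<Rightarrow> real \<Rightarrow> real) \<Rightarrow> real^'n \<Rightarrow> real \<Rightarrow> real \<Rightarrow> real \<Rightarrow> real^'n \<Rightarrow> real^'n" where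
  "grad_estimate f x \<xi>p \<xi>m \<tau> e =
     (real CARD('n) / (2 * \<tau>) * (f (x + \<tau> *\<^sub>R e) \<xi>p - f (x - \<tau> *\<^sub>R e) \<xi>m)) *\<^sub>R e"

text \<open>
  The uniform distribution on the unit sphere is taken to be the normalised cone measure (which is
  the normalised surface measure): the law of the direction of a point drawn uniformly from the unit
  ball. The value of \<^const>\<open>sgn\<close> at the origin is irrelevant, the origin being a null set.
  Rotation invariance is inherited from the Lebesgue measure and the ball.
\<close>

definition uniform_sphere :: "(real^'n) measure" where
  "uniform_sphere = distr (uniform_measure lborel (ball 0 1)) borel sgn"

lemma sets_uniform_sphere [simp, measurable_cong]: "sets uniform_sphere = sets borel"
  and space_uniform_sphere [simp]: "space uniform_sphere = UNIV"
  by (simp_all add: uniform_sphere_def)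

lemma emeasure_lborel_unit_ball:
  "emeasure lborel (ball (0::real^'n) 1) \<noteq> 0" "emeasure lborel (ball (0::real^'n) 1) \<noteq> \<infinity>"
  using content_ball_pos[of 1 "0::real^'n"] emeasure_bounded_finite[of "ball (0::real^'n) 1"]
  by (auto simp: measure_def)

lemma measurable_sgn_vec [measurable]: "(sgn :: real^'n \<Rightarrow> real^'n) \<in> borel_measurable borel"
  unfolding sgn_div_norm by measurable

lemma prob_space_uniform_sphere: "prob_space (uniform_sphere :: (real^'n) measure)"
  unfolding uniform_sphere_def
  by (intro prob_space.prob_space_distr prob_space_uniform_measure emeasure_lborel_unit_ball) auto

lemma AE_uniform_sphere: "AE u in (uniform_sphere :: (real^'n) measure). u \<in> sphere 0 1"
proof -
  have "AE x in uniform_measure lborel (ball (0::real^'n) 1). sgn x \<in> sphere 0 1"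
    using AE_lborel_singleton[of "0::real^'n"]
    by (intro AE_uniform_measureI) (auto simp: norm_sgn elim!: eventually_mono)
  then show ?thesis
    unfolding uniform_sphere_def by (subst AE_distr_iff) auto
qed

definition gen_sigma :: "'w measure \<Rightarrow> ('w \<Rightarrow> 'b::topological_space) \<Rightarrow> 'w set set" where
  "gen_sigma M X = sets (vimage_algebra (space M) X borel)"

text \<open>
  Everything generated before iteration \<open>k\<close>; the earlier iterates are functions of these draws.
\<close>

definition past :: "'w measure \<Rightarrow> (nat \<Rightarrow> 'w \<Rightarrow> real^'n) \<Rightarrow> (nat \<Rightarrow> 'w \<Rightarrow> real) \<Rightarrow>
    (nat \<Rightarrow> 'w \<Rightarrow> real) \<Rightarrow> nat \<Rightarrow> 'w set set" where
  "past M e \<xi>p \<xi>m k = sigma_sets (space M)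
     (\<Union>j\<in>{1..<k}. gen_sigma M (e j) \<union> gen_sigma M (\<xi>p j) \<union> gen_sigma M (\<xi>m j))"

text \<open>
  Mutual (not merely pairwise) independence. It is stated for sigma-algebras because
  \<^const>\<open>prob_space.indep_vars\<close> requires all variables to have the same codomain type.
\<close>

definition independent_draws :: "'w measure \<Rightarrow> (nat \<Rightarrow> 'w \<Rightarrow> real^'n) \<Rightarrow> (nat \<Rightarrow> 'w \<Rightarrow> real) \<Rightarrow>
    (nat \<Rightarrow> 'w \<Rightarrow> real) \<Rightarrow> nat \<Rightarrow> bool" where
  "independent_draws M e \<xi>p \<xi>m k \<longleftrightarrow> prob_space.indep_sets M
     (\<lambda>i. [gen_sigma M (e k), gen_sigma M (\<xi>p k), gen_sigma M (\<xi>m k), past M e \<xi>p \<xi>m k] ! i) {..<4}"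

text \<open>
  Square integrability is explicit because the Bochner integral of a non-integrable function is 0;
  on a probability space it also makes \<open>\<xi>\<close> itself integrable.
\<close>

definition admissible_noise :: "'w measure \<Rightarrow> real \<Rightarrow> ('w \<Rightarrow> real) \<Rightarrow> bool" where
  "admissible_noise M \<sigma> \<xi> \<longleftrightarrow> \<xi> \<in> borel_measurable M \<and> integrable M (\<lambda>\<omega>. (\<xi> \<omega>)\<^sup>2) \<and>
     (\<integral>\<omega>. \<xi> \<omega> \<partial>M) = 0 \<and> (\<integral>\<omega>. (\<xi> \<omega>)\<^sup>2 \<partial>M) \<le> \<sigma>\<^sup>2"

text \<open>
  The absolute constant hidden by the soft-O notation. It is a fixed number because an existential
  quantifier inside a theorem could depend on the type variables, hence on the dimension.
\<close>

definition soft_O_const :: real where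
  "soft_O_const = 3"

end

theory Submission
  imports Defs
begin

text \<open>
  Write \<open>r = x - x\<^sup>*\<close>. The two oracle values differ by \<open>2 \<tau> (A r \<bullet> e)\<close> plus noise, so a step of the method is
  \<open>r \<mapsto> r - \<gamma> (d (A r \<bullet> e) + noise) e\<close>. Two facts control the mean of the new squared distance. First, a
  uniform direction on the sphere is isotropic, \<open>E (u \<bullet> e) (v \<bullet> e) = E (u \<bullet> v) / d\<close> for vectors determined by the
  past (\<open>isotropic_direction\<close>); hence the linear term decreases the squared distance by \<open>2 \<gamma> E (r \<bullet> A r)\<close>, while
  the squared signal costs only \<open>d \<parallel>A r\<parallel>\<^sup>2\<close> instead of \<open>d\<^sup>2 \<parallel>A r\<parallel>\<^sup>2\<close>. Secondly, the noise has mean zero and is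
  independent of the direction and the past, so it contributes only through its second moment, which is of
  order \<open>d\<^sup>2 \<sigma>\<^sup>2 (\<parallel>r\<parallel>\<^sup>2 + \<tau>\<^sup>2) / \<tau>\<^sup>2\<close>. The part proportional to \<open>\<parallel>r\<parallel>\<^sup>2\<close> is the danger: it could outweigh the
  contraction, and the lower bound on \<open>\<tau>\<close> and the upper bound on \<open>\<gamma>\<close> together keep it
  below a fraction of \<open>\<gamma> \<mu> \<parallel>r\<parallel>\<^sup>2\<close>.

  The eigenvalue bounds enter as \<open>\<mu> \<parallel>r\<parallel>\<^sup>2 \<le> r \<bullet> A r\<close> and \<open>\<parallel>A r\<parallel>\<^sup>2 \<le> L (r \<bullet> A r)\<close>, obtained from the attained
  minimum of the Rayleigh quotient (\<open>Rayleigh_minimum_eigenvalue\<close>). Together these give the one-step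
  contraction by \<open>1 - \<gamma> \<mu> / 2\<close> with additive error \<open>4 \<gamma>\<^sup>2 d\<^sup>2 \<sigma>\<^sup>2\<close> (\<open>zo_step_contraction\<close>), whose iteration
  accumulates at most \<open>8 \<gamma> d\<^sup>2 \<sigma>\<^sup>2 / \<mu>\<close> (\<open>zoGD_constant_step\<close>). The tuned step size balances the exponential
  decay against this error (\<open>tuned_step_size_bound\<close>).
\<close>

section \<open>Spectral bounds for a symmetric matrix\<close>

text \<open>
  The form of \<open>B\<close> is nonnegative on every combination \<open>s v - t w\<close>, so its discriminant as a quadratic
  form in \<open>(s, t)\<close> cannot be positive. The statement is for semidefinite forms because it
  serves below for \<open>B - m I\<close> with \<open>m\<close> an eigenvalue of \<open>B\<close>, which is singular.
\<close>

lemma psd_Cauchy_Schwarz: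
  fixes B :: "real^'n^'n"
  assumes sym: "transpose B = B" and psd: "\<And>v. 0 \<le> v \<bullet> (B *v v)"
  shows "(v \<bullet> (B *v w))\<^sup>2 \<le> (v \<bullet> (B *v v)) * (w \<bullet> (B *v w))"
proof -
  define a b c where "a = v \<bullet> (B *v v)" and "b = v \<bullet> (B *v w)" and "c = w \<bullet> (B *v w)"
  have swap: "w \<bullet> (B *v v) = b"
    unfolding b_def by (metis dot_lmul_matrix inner_commute sym transpose_matrix_vector)
  have quadratic: "0 \<le> s\<^sup>2 * a - 2 * s * t * b + t\<^sup>2 * c" for s t
  proof -
    have "(s *\<^sub>R v - t *\<^sub>R w) \<bullet> (B *v (s *\<^sub>R v - t *\<^sub>R w)) = s\<^sup>2 * a - 2 * s * t * b + t\<^sup>2 * c"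
      using swap unfolding a_def b_def c_def
      by (simp add: matrix_vector_mult_diff_distrib matrix_vector_mult_scaleR
          inner_diff power2_eq_square algebra_simps)
    then show ?thesis using psd[of "s *\<^sub>R v - t *\<^sub>R w"] by simp
  qed
  have "0 \<le> a" "0 \<le> c" unfolding a_def c_def by (rule psd)+
  have "b\<^sup>2 \<le> a * c"
  proof (cases "a = 0")
    case True
    have "b = 0"
    proof (rule ccontr)
      assume "b \<noteq> 0"
      \<comment> \<open>with \<open>a = 0\<close> the form is affine in \<open>s\<close>; at this \<open>s\<close> it takes the value \<open>-1\<close>\<close>
      then show False using quadratic[of "(c + 1) / (2 * b)" 1] True by simp
    qed
    then show ?thesis using True by simp
  next
    case False
    then have "0 < a" using \<open>0 \<le> a\<close> by simp
    moreover have "0 \<le> a * (a * c - b\<^sup>2)"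
      using quadratic[of b a] by (simp add: power2_eq_square algebra_simps)
    ultimately show ?thesis by (simp add: zero_le_mult_iff)
  qed
  then show ?thesis unfolding a_def b_def c_def .
qed

text \<open>
  The minimum of the quadratic form over the compact unit sphere is attained. At a minimiser \<open>v0\<close> the
  positive semidefinite form of \<open>B - m I\<close> vanishes, and by the Cauchy--Schwarz inequality for that form
  \<open>(B - m I) v0\<close> is orthogonal to everything, in particular to itself. Thus the least value is an
  eigenvalue, which turns hypotheses on eigenvalues into bounds on the form without a spectral
  decomposition.
\<close>

lemma Rayleigh_minimum_eigenvalue:
  fixes B :: "real^'n^'n"
  assumes sym: "transpose B = B"
  obtains m where "eigenvalue B m" "\<And>v. m * (norm v)\<^sup>2 \<le> v \<bullet> (B *v v)"
proof -
  have "sphere (0::real^'n) 1 \<noteq> {}" by simp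
  moreover have "continuous_on (sphere 0 1) (\<lambda>v. v \<bullet> (B *v v))"
    by (intro continuous_intros linear_continuous_on bounded_linear.linear
        matrix_vector_mul_bounded_linear)
  ultimately obtain v0 where v0: "v0 \<in> sphere 0 1"
    and least: "\<And>v. v \<in> sphere 0 1 \<Longrightarrow> v0 \<bullet> (B *v v0) \<le> v \<bullet> (B *v v)"
    using continuous_attains_inf[of "sphere 0 1" "\<lambda>v. v \<bullet> (B *v v)"] by auto
  define m where "m = v0 \<bullet> (B *v v0)"
  have lower: "m * (norm v)\<^sup>2 \<le> v \<bullet> (B *v v)" for v
  proof (cases "v = 0")
    case False
    have "m \<le> sgn v \<bullet> (B *v sgn v)"
      unfolding m_def using False by (intro least) (simp add: norm_sgn)
    also have "\<dots> = (v \<bullet> (B *v v)) / (norm v)\<^sup>2"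
      by (simp add: sgn_div_norm matrix_vector_mult_scaleR power2_eq_square divide_inverse)
    finally show ?thesis using False by (simp add: pos_le_divide_eq)
  qed simp
  define C where "C = B - m *\<^sub>R mat 1"
  have C: "C *v v = B *v v - m *\<^sub>R v" for v
    unfolding C_def by (simp add: matrix_vector_mult_diff_rdistrib scaleR_matrix_vector_assoc[symmetric])
  have symC: "transpose C = C"
    using sym unfolding C_def transpose_def mat_def by (auto simp: vec_eq_iff)
  have psdC: "0 \<le> v \<bullet> (C *v v)" for v
    using lower[of v] by (simp add: C inner_diff_right dot_square_norm)
  have "v0 \<bullet> (C *v v0) = 0"
    using v0 by (simp add: C inner_diff_right dot_square_norm m_def)
  then have "((C *v v0) \<bullet> (C *v v0))\<^sup>2 \<le> 0"
    using psd_Cauchy_Schwarz[OF symC psdC, of "C *v v0" v0] by simp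
  then have "B *v v0 = m *\<^sub>R v0" by (simp add: C)
  moreover have "v0 \<noteq> 0" using v0 by auto
  ultimately have "eigenvalue B m" unfolding eigenvalue_def by auto
  with lower show ?thesis by (intro that)
qed

text \<open>
  The upper bound is the lower bound for \<open>- A\<close>, whose eigenvalues are the negated ones.
\<close>

lemma eigenvalue_bounds_quadratic_form:
  fixes A :: "real^'n^'n"
  assumes sym: "transpose A = A" and spec: "\<And>l. eigenvalue A l \<Longrightarrow> \<mu> \<le> l \<and> l \<le> L"
  shows "\<mu> * (norm v)\<^sup>2 \<le> v \<bullet> (A *v v)" and "v \<bullet> (A *v v) \<le> L * (norm v)\<^sup>2"
proof -
  obtain m where "eigenvalue A m" "m * (norm v)\<^sup>2 \<le> v \<bullet> (A *v v)"
    using Rayleigh_minimum_eigenvalue[OF sym] by blast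
  then show "\<mu> * (norm v)\<^sup>2 \<le> v \<bullet> (A *v v)"
    using spec[of m] by (meson mult_right_mono order_trans zero_le_power2)
next
  have neg: "(- A) *v w = - (A *v w)" for w
    by (simp add: matrix_vector_mult_def vec_eq_iff sum_negf)
  have "transpose (- A) = - A" using sym by (simp add: transpose_def vec_eq_iff)
  then obtain m where m: "eigenvalue (- A) m" "m * (norm v)\<^sup>2 \<le> v \<bullet> ((- A) *v v)"
    using Rayleigh_minimum_eigenvalue by blast
  from m(1) have "eigenvalue A (- m)"
    unfolding eigenvalue_def neg by (metis minus_minus scaleR_minus_left)
  then have "- m * (norm v)\<^sup>2 \<le> L * (norm v)\<^sup>2"
    using spec by (intro mult_right_mono) auto
  then show "v \<bullet> (A *v v) \<le> L * (norm v)\<^sup>2" using m(2) by (simp add: neg)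
qed

text \<open>
  The smoothness inequality \<open>\<parallel>\<nabla>f\<parallel>\<^sup>2 \<le> 2 L (f - min f)\<close> for a quadratic. Cauchy--Schwarz for the form of \<open>A\<close>,
  applied to \<open>A v\<close> and \<open>v\<close>, bounds \<open>\<parallel>A v\<parallel>\<^sup>4\<close> by the product of the forms at \<open>A v\<close> and at \<open>v\<close>; the first of
  them is at most \<open>L \<parallel>A v\<parallel>\<^sup>2\<close>, and one factor \<open>\<parallel>A v\<parallel>\<^sup>2\<close> cancels.
\<close>

lemma norm_gradient_le_quadratic_form:
  fixes A :: "real^'n^'n"
  assumes sym: "transpose A = A" and psd: "\<And>v. 0 \<le> v \<bullet> (A *v v)"
    and upper: "\<And>v. v \<bullet> (A *v v) \<le> L * (norm v)\<^sup>2"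
  shows "(norm (A *v v))\<^sup>2 \<le> L * (v \<bullet> (A *v v))"
proof (cases "A *v v = 0")
  case False
  let ?g = "A *v v"
  have "((norm ?g)\<^sup>2)\<^sup>2 \<le> (?g \<bullet> (A *v ?g)) * (v \<bullet> ?g)"
    using psd_Cauchy_Schwarz[OF sym psd, of ?g v] by (simp add: dot_square_norm)
  also have "\<dots> \<le> (L * (norm ?g)\<^sup>2) * (v \<bullet> ?g)"
    by (intro mult_right_mono upper psd)
  finally have "(norm ?g)\<^sup>2 * (norm ?g)\<^sup>2 \<le> (norm ?g)\<^sup>2 * (L * (v \<bullet> ?g))"
    by (simp add: power2_eq_square algebra_simps)
  then show ?thesis
    by (rule mult_left_le_imp_le) (use False in simp)
qed simp

section \<open>Second moments of the uniform distribution on the sphere\<close>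

text \<open>
  For distinct \<open>i\<close> and \<open>j\<close>, the rotation by a right angle in the plane of the coordinates \<open>i\<close> and \<open>j\<close>. It
  maps boxes to boxes, so its invariance of Lebesgue measure is immediate from the volumes of boxes, and it
  determines all second moments: exchanging the two coordinates equates their mean squares, while the sign
  forces their mixed moment to vanish.
\<close>

definition quarter_turn :: "'n \<Rightarrow> 'n \<Rightarrow> real^'n \<Rightarrow> real^'n" where
  "quarter_turn i j v = (\<chi> k. if k = i then v $ j else if k = j then - v $ i else v $ k)"

lemma measurable_quarter_turn [measurable]: "quarter_turn i j \<in> borel_measurable borel"
proof -
  have "continuous_on UNIV (\<lambda>v :: real^'a. if k = i then v $ j else if k = j then - v $ i else v $ k)"
    for k
    by (cases "k = i"; cases "k = j") (auto intro!: continuous_intros)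
  then have "continuous_on UNIV (quarter_turn i j)"
    unfolding quarter_turn_def by (rule continuous_on_vec_lambda)
  then show ?thesis by (rule borel_measurable_continuous_onI)
qed

lemma norm_quarter_turn:
  assumes "i \<noteq> j"
  shows "norm (quarter_turn i j v) = norm v"
proof -
  have "(\<Sum>k\<in>UNIV. (quarter_turn i j v $ k)\<^sup>2) = (\<Sum>k\<in>UNIV. (v $ Transposition.transpose i j k)\<^sup>2)"
    using assms by (intro sum.cong) (auto simp: quarter_turn_def Transposition.transpose_def)
  also have "\<dots> = (\<Sum>k\<in>UNIV. (v $ k)\<^sup>2)"
    using sum.permute[of "Transposition.transpose i j" UNIV "\<lambda>k. (v $ k)\<^sup>2"]
    by (simp add: permutes_swap_id o_def)
  finally show ?thesis by (simp add: norm_vec_def L2_set_def)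
qed

lemma sgn_quarter_turn:
  assumes "i \<noteq> j"
  shows "sgn (quarter_turn i j v) = quarter_turn i j (sgn v)"
  unfolding sgn_div_norm norm_quarter_turn[OF assms]
  by (simp add: quarter_turn_def vec_eq_iff)

lemma lborel_quarter_turn:
  assumes "i \<noteq> j"
  shows "distr lborel borel (quarter_turn i j) = (lborel :: (real^'n) measure)"
proof (rule lborel_eqI[symmetric])
  let ?t = "Transposition.transpose i j"
  fix l u :: "real^'n" assume lu: "\<And>b. b \<in> Basis \<Longrightarrow> l \<bullet> b \<le> u \<bullet> b"
  have le: "l $ k \<le> u $ k" for k
    using lu[of "axis k 1"] by (simp add: cart_eq_inner_axis)
  define l' u' where
    "l' = (\<chi> k. if k = j then l $ i else if k = i then - u $ j else l $ k)" and
    "u' = (\<chi> k. if k = j then u $ i else if k = i then - l $ j else u $ k)"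
  have le': "l' $ k \<le> u' $ k" for k using le by (auto simp: l'_def u'_def)
  have preimage: "quarter_turn i j -` box l u = box l' u'"
  proof (intro set_eqI iffI)
    fix v assume "v \<in> quarter_turn i j -` box l u"
    then have *: "l $ k < quarter_turn i j v $ k \<and> quarter_turn i j v $ k < u $ k" for k
      by (simp add: mem_box_cart)
    have "l' $ k < v $ k \<and> v $ k < u' $ k" for k
      using *[of k] *[of i] *[of j] assms
      by (auto simp: l'_def u'_def quarter_turn_def split: if_splits)
    then show "v \<in> box l' u'" by (simp add: mem_box_cart)
  next
    fix v assume "v \<in> box l' u'"
    then have *: "l' $ k < v $ k \<and> v $ k < u' $ k" for k by (simp add: mem_box_cart)
    have "l $ k < quarter_turn i j v $ k \<and> quarter_turn i j v $ k < u $ k" for k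
      using *[of k] *[of i] *[of j] assms
      by (auto simp: l'_def u'_def quarter_turn_def split: if_splits)
    then show "v \<in> quarter_turn i j -` box l u" by (simp add: mem_box_cart)
  qed
  have Basis_prod: "(\<Prod>c\<in>Basis. (b - a) \<bullet> c) = (\<Prod>k\<in>UNIV. b $ k - a $ k)" for a b :: "real^'n"
    by (simp add: Basis_vec_def cart_eq_inner_axis axis_eq_axis prod.UNION_disjoint inner_diff_left)
  have "(\<Prod>k\<in>UNIV. u' $ k - l' $ k) = (\<Prod>k\<in>UNIV. u $ ?t k - l $ ?t k)"
    using assms by (intro prod.cong) (auto simp: l'_def u'_def Transposition.transpose_def)
  also have "\<dots> = (\<Prod>k\<in>UNIV. u $ k - l $ k)"
    using prod.permute[of ?t UNIV "\<lambda>k. u $ k - l $ k"] by (simp add: permutes_swap_id o_def)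
  finally have volume: "(\<Prod>c\<in>Basis. (u' - l') \<bullet> c) = (\<Prod>c\<in>Basis. (u - l) \<bullet> c)"
    unfolding Basis_prod .
  have "l' \<bullet> c \<le> u' \<bullet> c" if "c \<in> Basis" for c
    using that le' by (auto simp: Basis_vec_def inner_axis)
  then have "emeasure lborel (box l' u') = (\<Prod>c\<in>Basis. (u' - l') \<bullet> c)"
    by (rule emeasure_lborel_box)
  then show "emeasure (distr lborel borel (quarter_turn i j)) (box l u) = (\<Prod>b\<in>Basis. (u - l) \<bullet> b)"
    by (simp add: emeasure_distr preimage volume)
qed simp

text \<open>
  A linear isometry that preserves Lebesgue measure preserves the uniform distribution on the unit ball, and
  it commutes with the projection \<^const>\<open>sgn\<close> to the sphere.
\<close>

lemma uniform_sphere_quarter_turn: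
  assumes "i \<noteq> j"
  shows "distr uniform_sphere borel (quarter_turn i j) = (uniform_sphere :: (real^'n) measure)"
proof -
  let ?T = "quarter_turn i j" and ?B = "ball (0::real^'n) 1"
  have ball: "distr (uniform_measure lborel ?B) borel ?T = uniform_measure lborel ?B"
  proof (rule measure_eqI)
    fix S assume "S \<in> sets (distr (uniform_measure lborel ?B) borel ?T)"
    then have S [measurable]: "S \<in> sets borel" by simp
    have "?B \<inter> ?T -` S = ?T -` (?B \<inter> S)"
      using norm_quarter_turn[OF assms] by auto
    then have "emeasure lborel (?B \<inter> ?T -` S) = emeasure (distr lborel borel ?T) (?B \<inter> S)"
      by (simp add: emeasure_distr)
    then have *: "emeasure lborel (?B \<inter> ?T -` S) = emeasure lborel (?B \<inter> S)"
      unfolding lborel_quarter_turn[OF assms] .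
    have "?T -` S \<in> sets borel" using measurable_sets[OF measurable_quarter_turn S] by simp
    then show "emeasure (distr (uniform_measure lborel ?B) borel ?T) S
        = emeasure (uniform_measure lborel ?B) S"
      using * by (subst emeasure_distr) simp_all
  qed simp
  have "distr uniform_sphere borel ?T = distr (uniform_measure lborel ?B) borel (\<lambda>x. ?T (sgn x))"
    unfolding uniform_sphere_def by (subst distr_distr) (auto simp: o_def)
  also have "\<dots> = distr (uniform_measure lborel ?B) borel (\<lambda>x. sgn (?T x))"
    by (simp add: sgn_quarter_turn[OF assms])
  also have "\<dots> = distr (distr (uniform_measure lborel ?B) borel ?T) borel sgn"
    by (subst distr_distr) (auto simp: o_def)
  finally show ?thesis unfolding ball uniform_sphere_def .
qed

lemma integrable_uniform_sphere_coordinates: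
  "integrable uniform_sphere (\<lambda>u :: real^'n. u $ i * u $ j)"
proof -
  interpret prob_space "uniform_sphere :: (real^'n) measure" by (rule prob_space_uniform_sphere)
  have bd: "\<bar>u $ i * u $ j\<bar> \<le> 1" if "norm u = 1" for u :: "real^'n"
  proof -
    have "\<bar>u $ i\<bar> * \<bar>u $ j\<bar> \<le> 1 * 1"
      using component_le_norm_cart[of u] that by (intro mult_mono) auto
    then show ?thesis by (simp add: abs_mult)
  qed
  show ?thesis
    by (rule integrable_const_bound[of _ 1])
       (use AE_uniform_sphere[where 'n='n] bd in \<open>auto elim!: eventually_mono\<close>)
qed

text \<open>
  A quarter turn sends \<open>u\<^sub>i u\<^sub>j\<close> to its negative and \<open>u\<^sub>i\<^sup>2\<close> to \<open>u\<^sub>j\<^sup>2\<close>. The \<open>d\<close> equal mean squares add up to the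
  mean of \<open>\<parallel>u\<parallel>\<^sup>2\<close>, which is 1.
\<close>

lemma uniform_sphere_second_moments:
  "(\<integral>u. u $ i * u $ j \<partial>(uniform_sphere :: (real^'n) measure)) = (if i = j then 1 / CARD('n) else 0)"
proof -
  let ?U = "uniform_sphere :: (real^'n) measure"
  let ?m = "\<lambda>i j. \<integral>u. u $ i * u $ j \<partial>?U"
  have turn: "?m k l = (\<integral>u. quarter_turn i j u $ k * quarter_turn i j u $ l \<partial>?U)"
    if "i \<noteq> j" for i j k l
  proof -
    have "?m k l = (\<integral>u. u $ k * u $ l \<partial>distr ?U borel (quarter_turn i j))"
      using uniform_sphere_quarter_turn[OF that] by simp
    also have "\<dots> = (\<integral>u. quarter_turn i j u $ k * quarter_turn i j u $ l \<partial>?U)"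
      by (rule integral_distr) auto
    finally show ?thesis .
  qed
  have off: "?m i j = 0" if "i \<noteq> j" for i j
  proof -
    have "?m i j = - ?m i j"
      using turn[OF that, of i j] that by (simp add: quarter_turn_def mult.commute)
    then show ?thesis by simp
  qed
  have diag: "?m i i = ?m j j" for i j
    using turn[of i j i i] by (cases "i = j") (auto simp: quarter_turn_def)
  interpret prob_space ?U by (rule prob_space_uniform_sphere)
  have "(\<Sum>k\<in>UNIV. ?m k k) = (\<integral>u. (\<Sum>k\<in>UNIV. u $ k * u $ k) \<partial>?U)"
    by (rule Bochner_Integration.integral_sum[symmetric])
       (rule integrable_uniform_sphere_coordinates)
  also have "\<dots> = (\<integral>u. 1 \<partial>?U)"
  proof (rule integral_cong_AE)
    show "AE u in ?U. (\<Sum>k\<in>UNIV. u $ k * u $ k) = 1"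
      using AE_uniform_sphere
    proof eventually_elim
      case (elim u)
      then have "u \<bullet> u = 1" by (simp add: dot_square_norm)
      then show ?case by (simp add: inner_vec_def)
    qed
  qed auto
  also have "\<dots> = 1" using prob_space by simp
  finally have "(\<Sum>k\<in>UNIV. ?m k k) = 1" .
  moreover have "(\<Sum>k\<in>UNIV. ?m k k) = (\<Sum>k\<in>(UNIV::'n set). ?m i i)"
    by (intro sum.cong refl diag)
  ultimately have "real CARD('n) * ?m i i = 1" by simp
  then have "?m i i = 1 / CARD('n)" by (simp add: field_simps)
  then show ?thesis using off[of i j] by (cases "i = j") simp_all
qed

section \<open>Independence of the current draw from the past\<close>

text \<open>
  Since \<^const>\<open>prob_space.indep_var\<close> asks for variables with a common codomain, independence of vectors
  and scalars is kept at the level of sigma-algebras and converted here, for real functions only.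
\<close>

lemma (in prob_space) indep_var_of_indep_sub_algebras:
  assumes ind: "indep_set (sets N1) (sets N2)" and space: "space N1 = space M" "space N2 = space M"
    and X: "X \<in> borel_measurable N1" and Y: "Y \<in> borel_measurable N2"
  shows "indep_var borel X borel Y"
proof -
  have sub: "sets N1 \<subseteq> events" "sets N2 \<subseteq> events"
    using indep_setD_ev1[OF ind] indep_setD_ev2[OF ind] .
  have "X \<in> borel_measurable M" "Y \<in> borel_measurable M"
    using sub space by (auto intro: measurable_from_subalg[OF _ X] measurable_from_subalg[OF _ Y]
        simp: subalgebra_def)
  moreover have "sigma_sets (space M) {X -` S \<inter> space M | S. S \<in> sets borel} \<subseteq> sets N1"
    unfolding space(1)[symmetric] by (intro sets.sigma_sets_subset) (auto intro: measurable_sets[OF X])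
  moreover have "sigma_sets (space M) {Y -` S \<inter> space M | S. S \<in> sets borel} \<subseteq> sets N2"
    unfolding space(2)[symmetric] by (intro sets.sigma_sets_subset) (auto intro: measurable_sets[OF Y])
  ultimately show ?thesis
    using ind unfolding indep_var_eq indep_sets2_eq by blast
qed

text \<open>
  Used with \<open>B\<close> consisting of the current direction and the past: the noise multiplies a quantity that
  depends on both, so pairwise independence would not suffice.
\<close>

lemma (in prob_space) indep_set_merge:
  assumes ind: "indep_sets E I" and a: "a \<in> I" and B: "B \<subseteq> I" "a \<notin> B"
    and stable: "\<And>i. i \<in> I \<Longrightarrow> Int_stable (E i)"
  shows "indep_set (E a) (sigma_sets (space M) (\<Union>i\<in>B. E i))"
proof -
  let ?I = "case_bool {a} B"
  have "indep_sets (\<lambda>b. sigma_sets (space M) (\<Union>i\<in>?I b. E i)) UNIV"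
  proof (rule indep_sets_collect_sigma)
    show "indep_sets E (\<Union>b. ?I b)"
      by (rule indep_sets_mono_index[OF _ ind]) (use a B in \<open>auto split: bool.splits\<close>)
    show "Int_stable (E i)" if "i \<in> ?I b" for i b
      using that a B by (intro stable) (auto split: bool.splits)
    show "disjoint_family ?I"
      using B by (auto simp: disjoint_family_on_def split: bool.splits)
  qed
  then show ?thesis
    unfolding indep_set_def
    by (rule indep_sets_mono_sets) (auto split: bool.splits)
qed

lemma gen_sigma_measurable:
  "X \<in> borel_measurable (vimage_algebra (space M) X borel)"
  by (rule measurable_vimage_algebra1) auto

lemma borel_measurable_vec_component [measurable (raw)]:
  fixes f :: "'a \<Rightarrow> real^'n"
  assumes "f \<in> borel_measurable N"
  shows "(\<lambda>\<omega>. f \<omega> $ i) \<in> borel_measurable N"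
  unfolding cart_eq_inner_axis using assms by measurable

text \<open>
  Expand both inner products in coordinates. Each term is a product of \<open>e\<^sub>i e\<^sub>j\<close> with a coordinate product of
  the past vectors, so its mean factors, and the second moments of \<open>e\<close> leave only the diagonal. This is
  the sense in which \<open>d (\<nabla>f \<bullet> e) e\<close> is an unbiased estimate of \<open>\<nabla>f\<close>, and it also gives the factor \<open>1/d\<close>
  in the mean of \<open>(\<nabla>f \<bullet> e)\<^sup>2\<close>.
\<close>

lemma (in prob_space) isotropic_direction:
  fixes e u v :: "'a \<Rightarrow> real^'n"
  assumes e: "e \<in> borel_measurable M" "distr M borel e = uniform_sphere"
    and ind: "indep_set (gen_sigma M e) (sets N)" and space: "space N = space M"
    and u: "u \<in> borel_measurable N" "integrable M (\<lambda>\<omega>. (norm (u \<omega>))\<^sup>2)"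
    and v: "v \<in> borel_measurable N" "integrable M (\<lambda>\<omega>. (norm (v \<omega>))\<^sup>2)"
  shows "integrable M (\<lambda>\<omega>. (u \<omega> \<bullet> e \<omega>) * (v \<omega> \<bullet> e \<omega>))"
    and "expectation (\<lambda>\<omega>. (u \<omega> \<bullet> e \<omega>) * (v \<omega> \<bullet> e \<omega>)) = expectation (\<lambda>\<omega>. u \<omega> \<bullet> v \<omega>) / CARD('n)"
proof -
  have sub: "sets N \<subseteq> events" by (rule indep_setD_ev2[OF ind])
  have [measurable]: "u \<in> borel_measurable M" "v \<in> borel_measurable M" "e \<in> borel_measurable M"
    using sub space e by (auto intro: measurable_from_subalg[OF _ u(1)] measurable_from_subalg[OF _ v(1)]
        simp: subalgebra_def)
  let ?c = "\<lambda>i j \<omega>. u \<omega> $ i * v \<omega> $ j" and ?ee = "\<lambda>i j \<omega>. e \<omega> $ i * e \<omega> $ j"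
  have coord: "integrable M (?c i j)" for i j
  proof (rule Bochner_Integration.integrable_bound)
    show "integrable M (\<lambda>\<omega>. (norm (u \<omega>))\<^sup>2 + (norm (v \<omega>))\<^sup>2)" using u v by simp
    show "AE \<omega> in M. norm (?c i j \<omega>) \<le> norm ((norm (u \<omega>))\<^sup>2 + (norm (v \<omega>))\<^sup>2)"
    proof (rule AE_I2)
      fix \<omega>
      have "\<bar>u \<omega> $ i\<bar> * \<bar>v \<omega> $ j\<bar> \<le> norm (u \<omega>) * norm (v \<omega>)"
        by (intro mult_mono component_le_norm_cart) auto
      also have "\<dots> \<le> (norm (u \<omega>))\<^sup>2 + (norm (v \<omega>))\<^sup>2"
        using sum_squares_bound[of "norm (u \<omega>)" "norm (v \<omega>)"]
          mult_nonneg_nonneg[OF norm_ge_zero[of "u \<omega>"] norm_ge_zero[of "v \<omega>"]]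
        by linarith
      finally show "norm (?c i j \<omega>) \<le> norm ((norm (u \<omega>))\<^sup>2 + (norm (v \<omega>))\<^sup>2)"
        by (simp add: abs_mult)
    qed
  qed measurable
  have dir: "integrable M (?ee i j)" "expectation (?ee i j) = (if i = j then 1 / CARD('n) else 0)" for i j
    using integrable_uniform_sphere_coordinates[of i j] uniform_sphere_second_moments[of i j]
    unfolding e(2)[symmetric] by (simp_all add: integrable_distr_eq integral_distr)
  have indv: "indep_var borel (?ee i j) borel (?c i j)" for i j
  proof (rule indep_var_of_indep_sub_algebras[OF ind[unfolded gen_sigma_def]])
    note gen_sigma_measurable[of e M, measurable] and u(1)[measurable] and v(1)[measurable]
    show "?ee i j \<in> borel_measurable (vimage_algebra (space M) e borel)" by measurable
    show "?c i j \<in> borel_measurable N" by measurable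
  qed (use space in auto)
  have int: "integrable M (\<lambda>\<omega>. ?ee i j \<omega> * ?c i j \<omega>)" for i j
    by (rule indep_var_integrable[OF indv dir(1) coord])
  have E: "expectation (\<lambda>\<omega>. ?ee i j \<omega> * ?c i j \<omega>) = (if i = j then expectation (?c i i) / CARD('n) else 0)" for i j
    using indep_var_lebesgue_integral[OF indv dir(1) coord] dir(2) by simp
  have expand: "(u \<omega> \<bullet> e \<omega>) * (v \<omega> \<bullet> e \<omega>) = (\<Sum>i\<in>UNIV. \<Sum>j\<in>UNIV. ?ee i j \<omega> * ?c i j \<omega>)" for \<omega>
    unfolding inner_vec_def sum_product by (simp add: mult_ac)
  show "integrable M (\<lambda>\<omega>. (u \<omega> \<bullet> e \<omega>) * (v \<omega> \<bullet> e \<omega>))"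
    unfolding expand by (intro Bochner_Integration.integrable_sum int)
  have "expectation (\<lambda>\<omega>. (u \<omega> \<bullet> e \<omega>) * (v \<omega> \<bullet> e \<omega>))
      = (\<Sum>i\<in>UNIV. \<Sum>j\<in>UNIV. expectation (\<lambda>\<omega>. ?ee i j \<omega> * ?c i j \<omega>))"
    unfolding expand by (simp add: int)
  also have "\<dots> = (\<Sum>i\<in>UNIV. expectation (?c i i)) / CARD('n)"
    unfolding E by (simp add: sum_divide_distrib)
  also have "(\<Sum>i\<in>UNIV. expectation (?c i i)) = expectation (\<lambda>\<omega>. u \<omega> \<bullet> v \<omega>)"
    unfolding inner_vec_def by (simp add: coord)
  finally show "expectation (\<lambda>\<omega>. (u \<omega> \<bullet> e \<omega>) * (v \<omega> \<bullet> e \<omega>)) = expectation (\<lambda>\<omega>. u \<omega> \<bullet> v \<omega>) / CARD('n)" .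
qed

section \<open>One iteration\<close>

text \<open>
  A central difference of a quadratic is exact, so the estimator has no discretisation bias and \<open>\<tau>\<close> enters
  only through the noise.
\<close>

lemma grad_estimate_noisy_quadratic:
  fixes A :: "real^'n^'n"
  assumes sym: "transpose A = A" and "0 < \<tau>"
  shows "grad_estimate (noisy_oracle A xs) x p m \<tau> e =
    (CARD('n) * ((A *v (x - xs)) \<bullet> e) + CARD('n) / (2 * \<tau>) *
      (p * norm (x - xs + \<tau> *\<^sub>R e) - m * norm (x - xs - \<tau> *\<^sub>R e))) *\<^sub>R e"
proof -
  let ?r = "x - xs"
  have shift: "x + \<tau> *\<^sub>R e - xs = ?r + \<tau> *\<^sub>R e" "x - \<tau> *\<^sub>R e - xs = ?r - \<tau> *\<^sub>R e" by simp_all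
  have swap: "?r \<bullet> (A *v e) = (A *v ?r) \<bullet> e" "e \<bullet> (A *v ?r) = (A *v ?r) \<bullet> e"
    by (metis dot_lmul_matrix inner_commute sym transpose_matrix_vector)+
  have polar: "(?r + \<tau> *\<^sub>R e) \<bullet> (A *v (?r + \<tau> *\<^sub>R e)) - (?r - \<tau> *\<^sub>R e) \<bullet> (A *v (?r - \<tau> *\<^sub>R e))
      = 4 * \<tau> * ((A *v ?r) \<bullet> e)"
    unfolding matrix_vector_right_distrib matrix_vector_mult_diff_distrib[of A ?r] matrix_vector_mult_scaleR
    by (simp only: inner_add_left inner_add_right inner_diff_left[of ?r] inner_diff_right[of _ "A *v ?r"]
        inner_scaleR_left inner_scaleR_right swap) (simp add: algebra_simps)
  have "noisy_oracle A xs (x + \<tau> *\<^sub>R e) p - noisy_oracle A xs (x - \<tau> *\<^sub>R e) m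
      = 2 * \<tau> * ((A *v ?r) \<bullet> e) + (p * norm (?r + \<tau> *\<^sub>R e) - m * norm (?r - \<tau> *\<^sub>R e))"
    using polar unfolding noisy_oracle_def shift by simp
  moreover have split: "d / (2 * \<tau>) * (2 * \<tau> * s + z) = d * s + d / (2 * \<tau>) * z" for d s z
    using \<open>0 < \<tau>\<close> by (simp add: field_simps)
  ultimately show ?thesis
    unfolding grad_estimate_def by (simp only: split)
qed

text \<open>
  Expand the square. The terms that are linear in \<open>p\<close> and \<open>m\<close> are kept exactly because they have mean zero;
  in the squared length of the estimate, the signal and the two noise values are separated by
  \<open>(a + b)\<^sup>2 \<le> 2 a\<^sup>2 + 2 b\<^sup>2\<close>. The parallelogram law bounds \<open>\<parallel>r \<plusminus> \<tau> e\<parallel>\<^sup>2\<close> by a quantity free of \<open>e\<close>, so each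
  squared noise value multiplies a function of \<open>r\<close> alone.
\<close>

lemma zo_step_pointwise_bound:
  fixes r g e :: "'b::real_inner" and d \<gamma> \<tau> p m :: real
  assumes e: "norm e = 1" and \<tau>: "0 < \<tau>"
  shows "(norm (r - \<gamma> *\<^sub>R ((d * (g \<bullet> e) + d / (2 * \<tau>) * (p * norm (r + \<tau> *\<^sub>R e) - m * norm (r - \<tau> *\<^sub>R e))) *\<^sub>R e)))\<^sup>2
    \<le> (norm r)\<^sup>2 - 2 * \<gamma> * d * ((g \<bullet> e) * (r \<bullet> e))
      - \<gamma> * d / \<tau> * (p * (norm (r + \<tau> *\<^sub>R e) * (r \<bullet> e)))
      + \<gamma> * d / \<tau> * (m * (norm (r - \<tau> *\<^sub>R e) * (r \<bullet> e)))
      + 2 * \<gamma>\<^sup>2 * d\<^sup>2 * ((g \<bullet> e) * (g \<bullet> e))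
      + 2 * \<gamma>\<^sup>2 * d\<^sup>2 / \<tau>\<^sup>2 * (p\<^sup>2 * ((norm r)\<^sup>2 + \<tau>\<^sup>2))
      + 2 * \<gamma>\<^sup>2 * d\<^sup>2 / \<tau>\<^sup>2 * (m\<^sup>2 * ((norm r)\<^sup>2 + \<tau>\<^sup>2))"
proof -
  define X Y s a b where "X = norm (r + \<tau> *\<^sub>R e)" and "Y = norm (r - \<tau> *\<^sub>R e)" and "s = r \<bullet> e"
    and "a = d * (g \<bullet> e)" and "b = d / (2 * \<tau>) * (p * X - m * Y)"
  have two: "(y + z)\<^sup>2 \<le> 2 * y\<^sup>2 + 2 * z\<^sup>2" for y z :: real
    using sum_squares_bound[of y z] by (simp add: power2_sum)
  have par: "X\<^sup>2 + Y\<^sup>2 = 2 * ((norm r)\<^sup>2 + \<tau>\<^sup>2)"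
    unfolding X_def Y_def using e
    by (simp add: power2_norm_eq_inner inner_simps inner_commute norm_eq_1)
       (simp add: power2_eq_square)
  have XY: "X\<^sup>2 \<le> 2 * ((norm r)\<^sup>2 + \<tau>\<^sup>2)" "Y\<^sup>2 \<le> 2 * ((norm r)\<^sup>2 + \<tau>\<^sup>2)"
    using par zero_le_power2[of X] zero_le_power2[of Y] by linarith+
  have "(p * X - m * Y)\<^sup>2 \<le> 2 * (p * X)\<^sup>2 + 2 * (m * Y)\<^sup>2"
    using two[of "p * X" "- (m * Y)"] by simp
  also have "\<dots> \<le> 2 * (p\<^sup>2 * (2 * ((norm r)\<^sup>2 + \<tau>\<^sup>2))) + 2 * (m\<^sup>2 * (2 * ((norm r)\<^sup>2 + \<tau>\<^sup>2)))"
    unfolding power_mult_distrib by (intro add_mono mult_left_mono XY) auto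
  finally have pm: "(p * X - m * Y)\<^sup>2 \<le> 4 * (p\<^sup>2 * ((norm r)\<^sup>2 + \<tau>\<^sup>2) + m\<^sup>2 * ((norm r)\<^sup>2 + \<tau>\<^sup>2))"
    by (simp add: algebra_simps)
  have "2 * b\<^sup>2 = d\<^sup>2 / (2 * \<tau>\<^sup>2) * (p * X - m * Y)\<^sup>2"
    unfolding b_def by (simp add: power_mult_distrib power_divide)
  also have "\<dots> \<le> d\<^sup>2 / (2 * \<tau>\<^sup>2) * (4 * (p\<^sup>2 * ((norm r)\<^sup>2 + \<tau>\<^sup>2) + m\<^sup>2 * ((norm r)\<^sup>2 + \<tau>\<^sup>2)))"
    by (intro mult_left_mono pm) simp
  also have "\<dots> = 2 * d\<^sup>2 / \<tau>\<^sup>2 * (p\<^sup>2 * ((norm r)\<^sup>2 + \<tau>\<^sup>2)) + 2 * d\<^sup>2 / \<tau>\<^sup>2 * (m\<^sup>2 * ((norm r)\<^sup>2 + \<tau>\<^sup>2))"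
    by (simp add: distrib_left add_divide_distrib)
  finally have b2: "(a + b)\<^sup>2 \<le> 2 * a\<^sup>2 + (2 * d\<^sup>2 / \<tau>\<^sup>2 * (p\<^sup>2 * ((norm r)\<^sup>2 + \<tau>\<^sup>2)) + 2 * d\<^sup>2 / \<tau>\<^sup>2 * (m\<^sup>2 * ((norm r)\<^sup>2 + \<tau>\<^sup>2)))"
    using two[of a b] by linarith
  have "(norm (r - \<gamma> *\<^sub>R ((a + b) *\<^sub>R e)))\<^sup>2 = (norm r)\<^sup>2 - 2 * \<gamma> * (a + b) * s + \<gamma>\<^sup>2 * (a + b)\<^sup>2"
    unfolding power2_norm_eq_inner s_def using e
    by (simp add: inner_simps inner_commute norm_eq_1 power2_eq_square algebra_simps)
  also have "\<dots> \<le> (norm r)\<^sup>2 - 2 * \<gamma> * (a + b) * s + \<gamma>\<^sup>2 *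
      (2 * a\<^sup>2 + (2 * d\<^sup>2 / \<tau>\<^sup>2 * (p\<^sup>2 * ((norm r)\<^sup>2 + \<tau>\<^sup>2)) + 2 * d\<^sup>2 / \<tau>\<^sup>2 * (m\<^sup>2 * ((norm r)\<^sup>2 + \<tau>\<^sup>2))))"
    using mult_left_mono[OF b2, of "\<gamma>\<^sup>2"] by simp
  also have "\<dots> = (norm r)\<^sup>2 - 2 * \<gamma> * d * ((g \<bullet> e) * s)
      - \<gamma> * d / \<tau> * (p * (X * s)) + \<gamma> * d / \<tau> * (m * (Y * s))
      + 2 * \<gamma>\<^sup>2 * d\<^sup>2 * ((g \<bullet> e) * (g \<bullet> e))
      + 2 * \<gamma>\<^sup>2 * d\<^sup>2 / \<tau>\<^sup>2 * (p\<^sup>2 * ((norm r)\<^sup>2 + \<tau>\<^sup>2))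
      + 2 * \<gamma>\<^sup>2 * d\<^sup>2 / \<tau>\<^sup>2 * (m\<^sup>2 * ((norm r)\<^sup>2 + \<tau>\<^sup>2))"
  proof -
    have "2 * \<gamma> * b * s = \<gamma> * d / \<tau> * (p * (X * s)) - \<gamma> * d / \<tau> * (m * (Y * s))"
      unfolding b_def using \<tau> by (simp add: field_simps)
    moreover have "a\<^sup>2 = d\<^sup>2 * ((g \<bullet> e) * (g \<bullet> e))"
      unfolding a_def by (simp add: power2_eq_square)
    ultimately show ?thesis by (simp add: a_def distrib_left distrib_right mult_ac)
  qed
  finally show ?thesis unfolding X_def Y_def s_def a_def b_def .
qed

lemma (in prob_space) independent_factor:
  fixes X Y :: "'a \<Rightarrow> real"
  assumes ind: "indep_set (gen_sigma M \<xi>) (sets N)" and space: "space N = space M"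
    and X: "X \<in> borel_measurable (vimage_algebra (space M) \<xi> borel)" "integrable M X"
    and Y: "Y \<in> borel_measurable N" "integrable M Y"
  shows "integrable M (\<lambda>\<omega>. X \<omega> * Y \<omega>)"
    and "expectation (\<lambda>\<omega>. X \<omega> * Y \<omega>) = expectation X * expectation Y"
proof -
  have "indep_var borel X borel Y"
    by (rule indep_var_of_indep_sub_algebras[OF ind[unfolded gen_sigma_def] _ space X(1) Y(1)]) simp
  then show "integrable M (\<lambda>\<omega>. X \<omega> * Y \<omega>)"
    and "expectation (\<lambda>\<omega>. X \<omega> * Y \<omega>) = expectation X * expectation Y"
    using X Y by (auto intro: indep_var_integrable indep_var_lebesgue_integral)
qed

text \<open>
  Taking means in the pointwise bound, with \<open>D = E \<parallel>r\<parallel>\<^sup>2\<close> and \<open>Q = E (r \<bullet> A r) \<ge> \<mu> D\<close>, gives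
  \<open>D - 2 \<gamma> Q + 2 \<gamma>\<^sup>2 d L Q + 4 \<gamma>\<^sup>2 d\<^sup>2 \<sigma>\<^sup>2 D / \<tau>\<^sup>2 + 4 \<gamma>\<^sup>2 d\<^sup>2 \<sigma>\<^sup>2\<close>. The bound on \<open>\<gamma>\<close> makes the third term at most
  \<open>2 \<gamma> Q / 5\<close>; the lower bound on \<open>\<tau>\<close> together with that on \<open>\<gamma>\<close> makes the fourth, which reflects that the
  noise grows with the distance to the minimiser, at most \<open>2 \<gamma> \<mu> D / 5\<close>. What remains is a contraction
  by at least \<open>6 \<gamma> \<mu> / 5\<close>, hence by the claimed \<open>\<gamma> \<mu> / 2\<close>.
\<close>

lemma (in prob_space) zo_step_contraction:
  fixes A :: "real^'n^'n" and x e :: "'a \<Rightarrow> real^'n" and p m :: "'a \<Rightarrow> real"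
  defines "d \<equiv> real CARD('n)"
  assumes sym: "transpose A = A"
    and lower: "\<And>v. \<mu> * (norm v)\<^sup>2 \<le> v \<bullet> (A *v v)"
    and grad: "\<And>v. (norm (A *v v))\<^sup>2 \<le> L * (v \<bullet> (A *v v))"
    and \<mu>L: "0 < \<mu>" "\<mu> \<le> L"
    and \<gamma>: "0 < \<gamma>" "\<gamma> \<le> 1 / (5 * d * L)"
    and \<tau>: "0 < \<tau>" "2 * d * \<sigma>\<^sup>2 / (\<mu> * L) \<le> \<tau>\<^sup>2"
    and e: "e \<in> borel_measurable M" "distr M borel e = uniform_sphere"
    and p: "admissible_noise M \<sigma> p" and m: "admissible_noise M \<sigma> m"
    and ind: "indep_sets (\<lambda>i. [gen_sigma M e, gen_sigma M p, gen_sigma M m, sets N] ! i) {..<4}"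
    and space: "space N = space M"
    and x: "x \<in> borel_measurable N" "integrable M (\<lambda>\<omega>. (norm (x \<omega> - xs))\<^sup>2)"
  defines "x' \<equiv> \<lambda>\<omega>. x \<omega> - \<gamma> *\<^sub>R grad_estimate (noisy_oracle A xs) (x \<omega>) (p \<omega>) (m \<omega>) \<tau> (e \<omega>)"
  shows "integrable M (\<lambda>\<omega>. (norm (x' \<omega> - xs))\<^sup>2)"
    and "expectation (\<lambda>\<omega>. (norm (x' \<omega> - xs))\<^sup>2)
      \<le> (1 - \<gamma> * \<mu> / 2) * expectation (\<lambda>\<omega>. (norm (x \<omega> - xs))\<^sup>2) + 4 * \<gamma>\<^sup>2 * d\<^sup>2 * \<sigma>\<^sup>2"
proof -
  let ?F = "\<lambda>i::nat. [gen_sigma M e, gen_sigma M p, gen_sigma M m, sets N] ! i"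
  have "i = 0 \<or> i = 1 \<or> i = 2 \<or> i = 3" if "i \<in> {..<4}" for i :: nat
    using that by auto
  then have stable: "Int_stable (?F i)" if "i \<in> {..<4}" for i
    unfolding gen_sigma_def using that by (fastforce simp: sets.Int_stable)
  have sub: "?F i \<subseteq> events" if "i \<in> {..<4}" for i
    using ind that unfolding indep_sets_def by auto
  have eN: "gen_sigma M e \<subseteq> events" "sets N \<subseteq> events" using sub[of 0] sub[of 3] by auto
  \<comment> \<open>everything determined before the noise of this iteration enters\<close>
  define G where "G = sigma (space M) (gen_sigma M e \<union> sets N)"
  have Pow: "gen_sigma M e \<union> sets N \<subseteq> Pow (space M)" using eN sets.sets_into_space by blast
  have G: "space G = space M" "sets G = sigma_sets (space M) (gen_sigma M e \<union> sets N)"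
    unfolding G_def using Pow by (simp_all add: space_measure_of sets_measure_of)
  have ind_eN: "indep_set (gen_sigma M e) (sets N)"
    using indep_set_merge[OF ind, of 0 "{3}"] stable space sets.sigma_sets_eq[of N] by simp
  have ind_p: "indep_set (gen_sigma M p) (sets G)" and ind_m: "indep_set (gen_sigma M m) (sets G)"
    using indep_set_merge[OF ind, of 1 "{0, 3}"] indep_set_merge[OF ind, of 2 "{0, 3}"] stable
    unfolding G(2) by simp_all
  have NG: "sets N \<subseteq> sets G" "gen_sigma M e \<subseteq> sets G" unfolding G(2) by auto
  have GM: "sets G \<subseteq> events" by (rule indep_setD_ev2[OF ind_p])

  define r where "r = (\<lambda>\<omega>. x \<omega> - xs)"
  have rN [measurable]: "r \<in> borel_measurable N" unfolding r_def using x(1) by measurable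
  have rG [measurable]: "r \<in> borel_measurable G"
    by (rule measurable_from_subalg[OF _ rN]) (simp add: subalgebra_def NG space G(1))
  have eG [measurable]: "e \<in> borel_measurable G"
    by (rule measurable_from_subalg[OF _ gen_sigma_measurable[of e M]])
      (use NG(2) G(1) in \<open>simp add: subalgebra_def gen_sigma_def\<close>)
  have [measurable]: "r \<in> borel_measurable M"
    by (rule measurable_from_subalg[OF _ rG]) (simp add: subalgebra_def GM G(1))
  note e(1)[measurable]
  have p_meas [measurable]: "p \<in> borel_measurable M" and m_meas [measurable]: "m \<in> borel_measurable M"
    using p m by (auto simp: admissible_noise_def)
  have A_meas [measurable]: "(\<lambda>v. A *v v) \<in> borel_measurable borel"
    by (intro borel_measurable_continuous_onI linear_continuous_on matrix_vector_mul_bounded_linear)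

  let ?R = "\<lambda>\<omega>. (norm (r \<omega>))\<^sup>2" and ?g = "\<lambda>\<omega>. A *v r \<omega>"
  have R: "integrable M ?R" using x(2) by (simp add: r_def)
  have L: "0 < L" using \<mu>L by simp
  have g_le: "norm (A *v v) \<le> L * norm v" for v
  proof -
    have "norm (A *v v) * norm (A *v v) \<le> norm (A *v v) * (L * norm v)"
      using order_trans[OF grad[of v] mult_left_mono[OF norm_cauchy_schwarz[of v "A *v v"]]] L
      by (simp add: power2_eq_square mult_ac)
    then show ?thesis using L by (cases "norm (A *v v) = 0") (auto simp: mult_le_cancel_left)
  qed
  have g: "integrable M (\<lambda>\<omega>. (norm (?g \<omega>))\<^sup>2)"
  proof (rule Bochner_Integration.integrable_bound)
    show "integrable M (\<lambda>\<omega>. L\<^sup>2 * ?R \<omega>)" using R by simp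
    show "AE \<omega> in M. norm ((norm (?g \<omega>))\<^sup>2) \<le> norm (L\<^sup>2 * ?R \<omega>)"
      using power_mono[OF g_le norm_ge_zero, of _ 2] by (auto simp: power_mult_distrib)
  qed measurable
  have q: "integrable M (\<lambda>\<omega>. r \<omega> \<bullet> ?g \<omega>)"
  proof (rule Bochner_Integration.integrable_bound)
    show "integrable M (\<lambda>\<omega>. L * ?R \<omega>)" using R by simp
    have "\<bar>r \<omega> \<bullet> ?g \<omega>\<bar> \<le> L * ?R \<omega>" for \<omega>
    proof -
      have "norm (r \<omega>) * norm (?g \<omega>) \<le> norm (r \<omega>) * (L * norm (r \<omega>))"
        by (intro mult_left_mono g_le) simp
      then show ?thesis
        using Cauchy_Schwarz_ineq2[of "r \<omega>" "?g \<omega>"] by (simp add: power2_eq_square mult_ac)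
    qed
    then show "AE \<omega> in M. norm (r \<omega> \<bullet> ?g \<omega>) \<le> norm (L * ?R \<omega>)" using L by auto
  qed measurable
  have gN: "?g \<in> borel_measurable N" by measurable
  note gr = isotropic_direction[OF e ind_eN space gN g rN R]
  note gg = isotropic_direction[OF e ind_eN space gN g gN g]

  have sphere: "AE \<omega> in M. norm (e \<omega>) = 1"
  proof -
    have "AE u in distr M borel e. u \<in> sphere 0 1" unfolding e(2) by (rule AE_uniform_sphere)
    then show ?thesis by (subst (asm) AE_distr_iff) auto
  qed
  \<comment> \<open>the coefficients of the noise in the cross term, \<open>s = \<tau>\<close> for \<open>p\<close> and \<open>s = - \<tau>\<close> for \<open>m\<close>\<close>
  let ?W = "\<lambda>s \<omega>. norm (r \<omega> + s *\<^sub>R e \<omega>) * (r \<omega> \<bullet> e \<omega>)"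
  have W: "integrable M (?W s)" for s
  proof (rule Bochner_Integration.integrable_bound)
    show "integrable M (\<lambda>\<omega>. 2 * ?R \<omega> + s\<^sup>2)" using R by simp
    show "AE \<omega> in M. norm (?W s \<omega>) \<le> norm (2 * ?R \<omega> + s\<^sup>2)"
      using sphere
    proof eventually_elim
      case (elim \<omega>)
      have "\<bar>?W s \<omega>\<bar> \<le> (norm (r \<omega>) + \<bar>s\<bar>) * norm (r \<omega>)"
        unfolding abs_mult
        using norm_triangle_ineq[of "r \<omega>" "s *\<^sub>R e \<omega>"] Cauchy_Schwarz_ineq2[of "r \<omega>" "e \<omega>"] elim
        by (intro mult_mono) auto
      also have "\<dots> \<le> 2 * ?R \<omega> + s\<^sup>2"
      proof -
        have "2 * (\<bar>s\<bar> * norm (r \<omega>)) \<le> s\<^sup>2 + ?R \<omega>"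
          using sum_squares_bound[of "\<bar>s\<bar>" "norm (r \<omega>)"] by (simp add: mult.assoc)
        moreover have "0 \<le> \<bar>s\<bar> * norm (r \<omega>)" by simp
        moreover have "(norm (r \<omega>) + \<bar>s\<bar>) * norm (r \<omega>) = ?R \<omega> + \<bar>s\<bar> * norm (r \<omega>)"
          by (simp add: power2_eq_square distrib_right)
        ultimately show ?thesis by linarith
      qed
      finally show ?case by simp
    qed
  qed measurable
  have WG: "?W s \<in> borel_measurable G" for s by measurable
  let ?V = "\<lambda>\<omega>. ?R \<omega> + \<tau>\<^sup>2"
  have V: "?V \<in> borel_measurable G" "integrable M ?V" using R by (measurable, simp)

  have noise: "integrable M (\<lambda>\<omega>. \<xi> \<omega> * ?W s \<omega>)" "expectation (\<lambda>\<omega>. \<xi> \<omega> * ?W s \<omega>) = 0"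
    "integrable M (\<lambda>\<omega>. (\<xi> \<omega>)\<^sup>2 * ?V \<omega>)"
    "expectation (\<lambda>\<omega>. (\<xi> \<omega>)\<^sup>2 * ?V \<omega>) \<le> \<sigma>\<^sup>2 * expectation ?V"
    if \<xi>: "admissible_noise M \<sigma> \<xi>" and ind\<xi>: "indep_set (gen_sigma M \<xi>) (sets G)" for \<xi> s
  proof -
    note gen_sigma_measurable[of \<xi> M, measurable]
    have sq: "integrable M (\<lambda>\<omega>. (\<xi> \<omega>)\<^sup>2)" and mean: "expectation \<xi> = 0"
      and var: "expectation (\<lambda>\<omega>. (\<xi> \<omega>)\<^sup>2) \<le> \<sigma>\<^sup>2" and meas: "\<xi> \<in> borel_measurable M"
      using \<xi> by (auto simp: admissible_noise_def)
    have int: "integrable M \<xi>" by (rule square_integrable_imp_integrable[OF meas sq])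
    have lin: "\<xi> \<in> borel_measurable (vimage_algebra (space M) \<xi> borel)"
      and quad: "(\<lambda>\<omega>. (\<xi> \<omega>)\<^sup>2) \<in> borel_measurable (vimage_algebra (space M) \<xi> borel)"
      by measurable
    show "integrable M (\<lambda>\<omega>. \<xi> \<omega> * ?W s \<omega>)" "expectation (\<lambda>\<omega>. \<xi> \<omega> * ?W s \<omega>) = 0"
      using independent_factor[OF ind\<xi> G(1) lin int WG W, of s] mean by simp_all
    show "integrable M (\<lambda>\<omega>. (\<xi> \<omega>)\<^sup>2 * ?V \<omega>)"
      by (rule independent_factor[OF ind\<xi> G(1) quad sq V])
    show "expectation (\<lambda>\<omega>. (\<xi> \<omega>)\<^sup>2 * ?V \<omega>) \<le> \<sigma>\<^sup>2 * expectation ?V"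
      unfolding independent_factor(2)[OF ind\<xi> G(1) quad sq V]
      by (intro mult_right_mono var integral_nonneg_AE) auto
  qed
  note np = noise(1,2)[OF p ind_p, of \<tau>] noise(3,4)[OF p ind_p]
    and nm = noise(1,2)[OF m ind_m, of "- \<tau>"] noise(3,4)[OF m ind_m]

  define U where "U = (\<lambda>\<omega>. ?R \<omega> - 2 * \<gamma> * d * ((?g \<omega> \<bullet> e \<omega>) * (r \<omega> \<bullet> e \<omega>))
      - \<gamma> * d / \<tau> * (p \<omega> * ?W \<tau> \<omega>) + \<gamma> * d / \<tau> * (m \<omega> * ?W (- \<tau>) \<omega>)
      + 2 * \<gamma>\<^sup>2 * d\<^sup>2 * ((?g \<omega> \<bullet> e \<omega>) * (?g \<omega> \<bullet> e \<omega>))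
      + 2 * \<gamma>\<^sup>2 * d\<^sup>2 / \<tau>\<^sup>2 * ((p \<omega>)\<^sup>2 * ?V \<omega>)
      + 2 * \<gamma>\<^sup>2 * d\<^sup>2 / \<tau>\<^sup>2 * ((m \<omega>)\<^sup>2 * ?V \<omega>))"
  have x': "x' \<omega> - xs = r \<omega> - \<gamma> *\<^sub>R ((d * (?g \<omega> \<bullet> e \<omega>) + d / (2 * \<tau>) *
      (p \<omega> * norm (r \<omega> + \<tau> *\<^sub>R e \<omega>) - m \<omega> * norm (r \<omega> - \<tau> *\<^sub>R e \<omega>))) *\<^sub>R e \<omega>)" for \<omega>
    unfolding x'_def r_def d_def grad_estimate_noisy_quadratic[OF sym \<tau>(1)] by (simp add: algebra_simps)
  have le_U: "AE \<omega> in M. (norm (x' \<omega> - xs))\<^sup>2 \<le> U \<omega>"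
    using sphere
  proof eventually_elim
    case (elim \<omega>)
    show ?case
      using zo_step_pointwise_bound[OF elim \<tau>(1), of "r \<omega>" \<gamma> d "?g \<omega>" "p \<omega>" "m \<omega>"]
      unfolding x' U_def by simp
  qed
  have U: "integrable M U"
    unfolding U_def
    by (intro Bochner_Integration.integrable_add Bochner_Integration.integrable_diff
        integrable_mult_right R gr gg np nm)
  have x'_meas: "(\<lambda>\<omega>. (norm (x' \<omega> - xs))\<^sup>2) \<in> borel_measurable M" unfolding x' by measurable
  show int': "integrable M (\<lambda>\<omega>. (norm (x' \<omega> - xs))\<^sup>2)"
    using le_U by (intro Bochner_Integration.integrable_bound[OF U x'_meas]) (auto elim!: eventually_mono)

  let ?D = "expectation ?R" and ?Q = "expectation (\<lambda>\<omega>. r \<omega> \<bullet> ?g \<omega>)"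
  have d: "1 \<le> d" unfolding d_def by (simp add: Suc_leI)
  have D0: "0 \<le> ?D" by (intro integral_nonneg_AE) simp
  have DQ: "\<mu> * ?D \<le> ?Q"
    using integral_mono[OF integrable_mult_right[OF R, of \<mu>] q lower] by simp
  have EG: "expectation (\<lambda>\<omega>. ?g \<omega> \<bullet> ?g \<omega>) \<le> L * ?Q"
    using integral_mono[OF g integrable_mult_right[OF q, of L] grad] by (simp add: power2_norm_eq_inner)
  have gr_E: "d * expectation (\<lambda>\<omega>. (?g \<omega> \<bullet> e \<omega>) * (r \<omega> \<bullet> e \<omega>)) = ?Q"
    unfolding gr(2) d_def by (simp add: inner_commute)
  have gg_E: "d\<^sup>2 * expectation (\<lambda>\<omega>. (?g \<omega> \<bullet> e \<omega>) * (?g \<omega> \<bullet> e \<omega>)) \<le> d * (L * ?Q)"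
    using mult_left_mono[OF EG, of d] d unfolding gg(2) d_def[symmetric] by (simp add: power2_eq_square)
  have V_E: "expectation ?V = ?D + \<tau>\<^sup>2" using R by (simp add: prob_space)

  have "expectation (\<lambda>\<omega>. (norm (x' \<omega> - xs))\<^sup>2) \<le> expectation U"
    by (rule integral_mono_AE[OF int' U le_U])
  also have "\<dots> = ?D - 2 * \<gamma> * d * expectation (\<lambda>\<omega>. (?g \<omega> \<bullet> e \<omega>) * (r \<omega> \<bullet> e \<omega>))
      - \<gamma> * d / \<tau> * expectation (\<lambda>\<omega>. p \<omega> * ?W \<tau> \<omega>) + \<gamma> * d / \<tau> * expectation (\<lambda>\<omega>. m \<omega> * ?W (- \<tau>) \<omega>)
      + 2 * \<gamma>\<^sup>2 * d\<^sup>2 * expectation (\<lambda>\<omega>. (?g \<omega> \<bullet> e \<omega>) * (?g \<omega> \<bullet> e \<omega>))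
      + 2 * \<gamma>\<^sup>2 * d\<^sup>2 / \<tau>\<^sup>2 * expectation (\<lambda>\<omega>. (p \<omega>)\<^sup>2 * ?V \<omega>)
      + 2 * \<gamma>\<^sup>2 * d\<^sup>2 / \<tau>\<^sup>2 * expectation (\<lambda>\<omega>. (m \<omega>)\<^sup>2 * ?V \<omega>)"
    unfolding U_def
    by (simp only: Bochner_Integration.integral_add Bochner_Integration.integral_diff integral_mult_right_zero
        Bochner_Integration.integrable_add Bochner_Integration.integrable_diff
        integrable_mult_right R gr(1) gg(1) np(1,3) nm(1,3))
  also have "\<dots> \<le> ?D - 2 * \<gamma> * ?Q + 2 * \<gamma>\<^sup>2 * (d * (L * ?Q))
      + 2 * \<gamma>\<^sup>2 * d\<^sup>2 / \<tau>\<^sup>2 * (\<sigma>\<^sup>2 * (?D + \<tau>\<^sup>2)) + 2 * \<gamma>\<^sup>2 * d\<^sup>2 / \<tau>\<^sup>2 * (\<sigma>\<^sup>2 * (?D + \<tau>\<^sup>2))"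
  proof -
    have "2 * \<gamma> * d * expectation (\<lambda>\<omega>. (?g \<omega> \<bullet> e \<omega>) * (r \<omega> \<bullet> e \<omega>)) = 2 * \<gamma> * ?Q"
      unfolding gr_E[symmetric] by simp
    moreover have "2 * \<gamma>\<^sup>2 * d\<^sup>2 * expectation (\<lambda>\<omega>. (?g \<omega> \<bullet> e \<omega>) * (?g \<omega> \<bullet> e \<omega>)) \<le> 2 * \<gamma>\<^sup>2 * (d * (L * ?Q))"
      using mult_left_mono[OF gg_E, of "2 * \<gamma>\<^sup>2"] by (simp add: mult.assoc)
    moreover have "2 * \<gamma>\<^sup>2 * d\<^sup>2 / \<tau>\<^sup>2 * expectation (\<lambda>\<omega>. (p \<omega>)\<^sup>2 * ?V \<omega>) \<le> 2 * \<gamma>\<^sup>2 * d\<^sup>2 / \<tau>\<^sup>2 * (\<sigma>\<^sup>2 * (?D + \<tau>\<^sup>2))"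
      using np(4) unfolding V_E by (intro mult_left_mono) auto
    moreover have "2 * \<gamma>\<^sup>2 * d\<^sup>2 / \<tau>\<^sup>2 * expectation (\<lambda>\<omega>. (m \<omega>)\<^sup>2 * ?V \<omega>) \<le> 2 * \<gamma>\<^sup>2 * d\<^sup>2 / \<tau>\<^sup>2 * (\<sigma>\<^sup>2 * (?D + \<tau>\<^sup>2))"
      using nm(4) unfolding V_E by (intro mult_left_mono) auto
    ultimately show ?thesis unfolding np(2) nm(2) by linarith
  qed
  also have "\<dots> = ?D - 2 * \<gamma> * ?Q + 2 * \<gamma> * (\<gamma> * d * L) * ?Q
      + 4 * \<gamma>\<^sup>2 * d * (d * \<sigma>\<^sup>2 / \<tau>\<^sup>2) * ?D + 4 * \<gamma>\<^sup>2 * d\<^sup>2 * \<sigma>\<^sup>2"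
    using \<tau>(1) by (simp add: distrib_left add_divide_distrib power2_eq_square)
  also have "\<dots> \<le> ?D - 2 * \<gamma> * ?Q + 2 * \<gamma> * (1 / 5) * ?Q + 2 / 5 * \<gamma> * \<mu> * ?D + 4 * \<gamma>\<^sup>2 * d\<^sup>2 * \<sigma>\<^sup>2"
  proof -
    have Q0: "0 \<le> ?Q" using DQ mult_nonneg_nonneg[of \<mu> ?D] D0 \<mu>L by linarith
    have step: "\<gamma> * d * L \<le> 1 / 5" using \<gamma> d L by (simp add: field_simps)
    have radius: "d * \<sigma>\<^sup>2 / \<tau>\<^sup>2 \<le> \<mu> * L / 2" using \<tau> \<mu>L L by (simp add: field_simps)
    have "4 * \<gamma>\<^sup>2 * d * (d * \<sigma>\<^sup>2 / \<tau>\<^sup>2) \<le> 4 * \<gamma>\<^sup>2 * d * (\<mu> * L / 2)"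
      using d by (intro mult_left_mono radius) simp
    also have "\<dots> = 2 * \<gamma> * \<mu> * (\<gamma> * d * L)" by (simp add: power2_eq_square)
    also have "\<dots> \<le> 2 * \<gamma> * \<mu> * (1 / 5)" using \<gamma> \<mu>L by (intro mult_left_mono step) simp
    finally have "4 * \<gamma>\<^sup>2 * d * (d * \<sigma>\<^sup>2 / \<tau>\<^sup>2) * ?D \<le> 2 / 5 * \<gamma> * \<mu> * ?D"
      using D0 by (intro mult_right_mono) simp_all
    moreover have "2 * \<gamma> * (\<gamma> * d * L) * ?Q \<le> 2 * \<gamma> * (1 / 5) * ?Q"
      using \<gamma> Q0 by (intro mult_right_mono mult_left_mono step) simp_all
    ultimately show ?thesis by linarith
  qed
  also have "\<dots> \<le> (1 - \<gamma> * \<mu> / 2) * ?D + 4 * \<gamma>\<^sup>2 * d\<^sup>2 * \<sigma>\<^sup>2"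
  proof -
    have "\<gamma> * (\<mu> * ?D) \<le> \<gamma> * ?Q" using \<gamma> by (intro mult_left_mono DQ) simp
    moreover have "0 \<le> \<gamma> * (\<mu> * ?D)" using \<gamma> \<mu>L D0 by simp
    ultimately show ?thesis by (simp add: algebra_simps)
  qed
  finally show "expectation (\<lambda>\<omega>. (norm (x' \<omega> - xs))\<^sup>2)
      \<le> (1 - \<gamma> * \<mu> / 2) * expectation (\<lambda>\<omega>. (norm (x \<omega> - xs))\<^sup>2) + 4 * \<gamma>\<^sup>2 * d\<^sup>2 * \<sigma>\<^sup>2"
    unfolding r_def .
qed

section \<open>The recursion along the iterates\<close>

lemma gen_sigma_subset_Pow: "gen_sigma M X \<subseteq> Pow (space M)"
  unfolding gen_sigma_def using sets.space_closed[of "vimage_algebra (space M) X borel"] by simp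

text \<open>
  The sigma-algebra \<^const>\<open>past\<close> as a measure space, so that the iterates can be called measurable with
  respect to it.
\<close>

definition history :: "'w measure \<Rightarrow> (nat \<Rightarrow> 'w \<Rightarrow> real^'n) \<Rightarrow> (nat \<Rightarrow> 'w \<Rightarrow> real) \<Rightarrow>
    (nat \<Rightarrow> 'w \<Rightarrow> real) \<Rightarrow> nat \<Rightarrow> 'w measure" where
  "history M e \<xi>p \<xi>m k = sigma (space M)
     (\<Union>j\<in>{1..<k}. gen_sigma M (e j) \<union> gen_sigma M (\<xi>p j) \<union> gen_sigma M (\<xi>m j))"

lemma space_history [simp]: "space (history M e \<xi>p \<xi>m k) = space M"
  and sets_history: "sets (history M e \<xi>p \<xi>m k) = past M e \<xi>p \<xi>m k"
proof -
  have "(\<Union>j\<in>{1..<k}. gen_sigma M (e j) \<union> gen_sigma M (\<xi>p j) \<union> gen_sigma M (\<xi>m j)) \<subseteq> Pow (space M)"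
    by (intro UN_least Un_least gen_sigma_subset_Pow)
  then show "space (history M e \<xi>p \<xi>m k) = space M" "sets (history M e \<xi>p \<xi>m k) = past M e \<xi>p \<xi>m k"
    unfolding history_def past_def by (simp_all add: space_measure_of sets_measure_of)
qed

lemma measurable_history:
  assumes "gen_sigma M X \<subseteq> past M e \<xi>p \<xi>m k"
  shows "X \<in> borel_measurable (history M e \<xi>p \<xi>m k)"
  by (rule measurable_from_subalg[OF _ gen_sigma_measurable[of X M]])
    (use assms in \<open>simp add: subalgebra_def gen_sigma_def sets_history\<close>)

lemma history_draws:
  assumes "1 \<le> k"
  shows "e k \<in> borel_measurable (history M e \<xi>p \<xi>m (Suc k))"
    and "\<xi>p k \<in> borel_measurable (history M e \<xi>p \<xi>m (Suc k))"
    and "\<xi>m k \<in> borel_measurable (history M e \<xi>p \<xi>m (Suc k))"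
proof -
  have "gen_sigma M (e k) \<union> gen_sigma M (\<xi>p k) \<union> gen_sigma M (\<xi>m k)
      \<subseteq> (\<Union>j\<in>{1..<Suc k}. gen_sigma M (e j) \<union> gen_sigma M (\<xi>p j) \<union> gen_sigma M (\<xi>m j))"
    using assms by (intro UN_upper) simp
  then have "gen_sigma M (e k) \<union> gen_sigma M (\<xi>p k) \<union> gen_sigma M (\<xi>m k) \<subseteq> past M e \<xi>p \<xi>m (Suc k)"
    unfolding past_def by (rule order_trans[OF _ sigma_sets_superset_generator])
  then show "e k \<in> borel_measurable (history M e \<xi>p \<xi>m (Suc k))"
    and "\<xi>p k \<in> borel_measurable (history M e \<xi>p \<xi>m (Suc k))"
    and "\<xi>m k \<in> borel_measurable (history M e \<xi>p \<xi>m (Suc k))"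
    by (auto intro!: measurable_history)
qed

lemma history_mono:
  "subalgebra (history M e \<xi>p \<xi>m (Suc k)) (history M e \<xi>p \<xi>m k)"
proof -
  have "past M e \<xi>p \<xi>m k \<subseteq> past M e \<xi>p \<xi>m (Suc k)"
    unfolding past_def by (intro sigma_sets_mono' UN_mono) auto
  then show ?thesis by (simp add: subalgebra_def sets_history)
qed

lemma measurable_noisy_oracle:
  fixes A :: "real^'n^'n"
  assumes [measurable]: "X \<in> borel_measurable N" "\<xi> \<in> borel_measurable N"
  shows "(\<lambda>\<omega>. noisy_oracle A xs (X \<omega>) (\<xi> \<omega>)) \<in> borel_measurable N"
proof -
  have [measurable]: "(\<lambda>v. A *v v) \<in> borel_measurable borel"
    by (intro borel_measurable_continuous_onI linear_continuous_on matrix_vector_mul_bounded_linear)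
  show ?thesis unfolding noisy_oracle_def by measurable
qed

lemma measurable_zo_step:
  fixes A :: "real^'n^'n"
  assumes [measurable]: "X \<in> borel_measurable N" "e \<in> borel_measurable N"
    "p \<in> borel_measurable N" "m \<in> borel_measurable N"
  shows "(\<lambda>\<omega>. X \<omega> - \<gamma> *\<^sub>R grad_estimate (noisy_oracle A xs) (X \<omega>) (p \<omega>) (m \<omega>) \<tau> (e \<omega>)) \<in> borel_measurable N"
proof -
  have [measurable]: "(\<lambda>\<omega>. noisy_oracle A xs (X \<omega> + \<tau> *\<^sub>R e \<omega>) (p \<omega>)) \<in> borel_measurable N"
    "(\<lambda>\<omega>. noisy_oracle A xs (X \<omega> - \<tau> *\<^sub>R e \<omega>) (m \<omega>)) \<in> borel_measurable N"
    by (intro measurable_noisy_oracle; measurable)+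
  show ?thesis unfolding grad_estimate_def by measurable
qed

text \<open>
  Measurability of the iterate with respect to the history must be carried along, since it is what makes the
  next draw independent of the iterate. The additive constant is the fixed point of
  \<open>b \<mapsto> (1 - \<gamma> \<mu> / 2) b + 4 \<gamma>\<^sup>2 d\<^sup>2 \<sigma>\<^sup>2\<close>, so it reproduces itself at every step.
\<close>

lemma zoGD_constant_step:
  fixes A :: "real^'n^'n" and xs x1 :: "real^'n"
    and e x :: "nat \<Rightarrow> 'w \<Rightarrow> real^'n" and \<xi>p \<xi>m :: "nat \<Rightarrow> 'w \<Rightarrow> real"
  assumes d_def: "d = real CARD('n)"
    and \<mu>_L: "0 < \<mu>" "\<mu> \<le> L"
    and A: "transpose A = A" "\<And>l. eigenvalue A l \<Longrightarrow> \<mu> \<le> l \<and> l \<le> L"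
    and \<gamma>: "0 < \<gamma>" "\<gamma> \<le> 1 / (5 * d * L)"
    and \<tau>: "\<And>k. k \<in> {1..K} \<Longrightarrow> 0 < \<tau> k \<and> sqrt (2 * d * \<sigma>\<^sup>2 / (\<mu> * L)) \<le> \<tau> k"
    and M: "prob_space M"
    and e: "\<And>k. k \<in> {1..K} \<Longrightarrow> e k \<in> borel_measurable M \<and> distr M borel (e k) = uniform_sphere"
    and \<xi>: "\<And>k. k \<in> {1..K} \<Longrightarrow> admissible_noise M \<sigma> (\<xi>p k) \<and> admissible_noise M \<sigma> (\<xi>m k)"
    and indep: "\<And>k. k \<in> {1..K} \<Longrightarrow> independent_draws M e \<xi>p \<xi>m k"
    and start: "\<And>\<omega>. \<omega> \<in> space M \<Longrightarrow> x 1 \<omega> = x1"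
    and step: "\<And>k \<omega>. k \<in> {1..K} \<Longrightarrow> \<omega> \<in> space M \<Longrightarrow>
      x (k + 1) \<omega> = x k \<omega> -
        \<gamma> *\<^sub>R grad_estimate (noisy_oracle A xs) (x k \<omega>) (\<xi>p k \<omega>) (\<xi>m k \<omega>) (\<tau> k) (e k \<omega>)"
    and "n \<le> K"
  shows "x (n + 1) \<in> borel_measurable (history M e \<xi>p \<xi>m (n + 1)) \<and>
    integrable M (\<lambda>\<omega>. (norm (x (n + 1) \<omega> - xs))\<^sup>2) \<and>
    (\<integral>\<omega>. (norm (x (n + 1) \<omega> - xs))\<^sup>2 \<partial>M)
      \<le> (1 - \<gamma> * \<mu> / 2) ^ n * (norm (x1 - xs))\<^sup>2 + 8 * d\<^sup>2 * \<gamma> * \<sigma>\<^sup>2 / \<mu>"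
  using \<open>n \<le> K\<close>
proof (induction n)
  interpret prob_space M by fact
  case 0
  have "x 1 \<in> borel_measurable (history M e \<xi>p \<xi>m 1)"
    by (subst measurable_cong[of _ _ "\<lambda>_. x1"]) (auto simp: start[unfolded One_nat_def])
  moreover have "integrable M (\<lambda>\<omega>. (norm (x 1 \<omega> - xs))\<^sup>2)"
    by (subst Bochner_Integration.integrable_cong[of _ _ _ "\<lambda>_. (norm (x1 - xs))\<^sup>2"]) (auto simp: start[unfolded One_nat_def])
  moreover have "(\<integral>\<omega>. (norm (x 1 \<omega> - xs))\<^sup>2 \<partial>M) = (\<integral>\<omega>. (norm (x1 - xs))\<^sup>2 \<partial>M)"
    by (intro Bochner_Integration.integral_cong) (auto simp: start[unfolded One_nat_def])
  moreover have "0 \<le> 8 * d\<^sup>2 * \<gamma> * \<sigma>\<^sup>2 / \<mu>" using \<gamma> \<mu>_L by simp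
  ultimately show ?case by (simp add: prob_space)
next
  interpret prob_space M by fact
  case (Suc n)
  let ?k = "n + 1" and ?q = "1 - \<gamma> * \<mu> / 2" and ?b = "8 * d\<^sup>2 * \<gamma> * \<sigma>\<^sup>2 / \<mu>"
  let ?H = "history M e \<xi>p \<xi>m"
  let ?x' = "\<lambda>\<omega>. x ?k \<omega> -
    \<gamma> *\<^sub>R grad_estimate (noisy_oracle A xs) (x ?k \<omega>) (\<xi>p ?k \<omega>) (\<xi>m ?k \<omega>) (\<tau> ?k) (e ?k \<omega>)"
  have k: "?k \<in> {1..K}" using Suc.prems by simp
  then have IH: "x ?k \<in> borel_measurable (?H ?k)" "integrable M (\<lambda>\<omega>. (norm (x ?k \<omega> - xs))\<^sup>2)"
    "expectation (\<lambda>\<omega>. (norm (x ?k \<omega> - xs))\<^sup>2) \<le> ?q ^ n * (norm (x1 - xs))\<^sup>2 + ?b"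
    using Suc.IH by auto
  have x': "x (Suc n + 1) \<omega> = ?x' \<omega>" if "\<omega> \<in> space M" for \<omega>
    using step[OF k that] by simp
  have "?x' \<in> borel_measurable (?H (Suc ?k))"
    by (intro measurable_zo_step history_draws measurable_from_subalg[OF history_mono IH(1)]) simp_all
  then have meas: "x (Suc n + 1) \<in> borel_measurable (?H (Suc n + 1))"
    by (subst measurable_cong[of _ _ ?x']) (use x' in simp_all)

  have lower: "\<mu> * (norm v)\<^sup>2 \<le> v \<bullet> (A *v v)" and upper: "v \<bullet> (A *v v) \<le> L * (norm v)\<^sup>2" for v
    using eigenvalue_bounds_quadratic_form[OF A] by auto
  have "0 \<le> v \<bullet> (A *v v)" for v
    using \<mu>_L by (intro order_trans[OF _ lower]) simp
  then have grad: "(norm (A *v v))\<^sup>2 \<le> L * (v \<bullet> (A *v v))" for v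
    using norm_gradient_le_quadratic_form[OF A(1) _ upper] by blast
  have "(sqrt (2 * d * \<sigma>\<^sup>2 / (\<mu> * L)))\<^sup>2 \<le> (\<tau> ?k)\<^sup>2"
    using \<tau>[OF k] \<mu>_L by (intro power_mono) (auto simp: d_def)
  then have \<tau>2: "2 * d * \<sigma>\<^sup>2 / (\<mu> * L) \<le> (\<tau> ?k)\<^sup>2"
    using \<mu>_L by (simp add: d_def)
  have ind: "indep_sets (\<lambda>i. [gen_sigma M (e ?k), gen_sigma M (\<xi>p ?k), gen_sigma M (\<xi>m ?k), sets (?H ?k)] ! i) {..<4}"
    using indep[OF k] unfolding independent_draws_def sets_history .
  have draws: "0 < \<tau> ?k" "e ?k \<in> borel_measurable M" "distr M borel (e ?k) = uniform_sphere"
    "admissible_noise M \<sigma> (\<xi>p ?k)" "admissible_noise M \<sigma> (\<xi>m ?k)"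
    using e[OF k] \<xi>[OF k] \<tau>[OF k] by auto
  have int: "integrable M (\<lambda>\<omega>. (norm (?x' \<omega> - xs))\<^sup>2)"
    by (rule zo_step_contraction(1)[where A=A and N="?H ?k" and L=L and \<mu>=\<mu> and \<sigma>=\<sigma>])
      (fact A lower grad \<mu>_L \<gamma>[unfolded d_def] draws \<tau>2[unfolded d_def] ind space_history IH)+
  have bound: "expectation (\<lambda>\<omega>. (norm (?x' \<omega> - xs))\<^sup>2)
      \<le> ?q * expectation (\<lambda>\<omega>. (norm (x ?k \<omega> - xs))\<^sup>2) + 4 * \<gamma>\<^sup>2 * d\<^sup>2 * \<sigma>\<^sup>2"
    unfolding d_def
    by (rule zo_step_contraction(2)[where A=A and N="?H ?k" and L=L and \<mu>=\<mu> and \<sigma>=\<sigma>])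
      (fact A lower grad \<mu>_L \<gamma>[unfolded d_def] draws \<tau>2[unfolded d_def] ind space_history IH)+
  have "integrable M (\<lambda>\<omega>. (norm (x (Suc n + 1) \<omega> - xs))\<^sup>2)"
    by (subst Bochner_Integration.integrable_cong[OF refl, of _ _ "\<lambda>\<omega>. (norm (?x' \<omega> - xs))\<^sup>2"])
      (use x' int in simp_all)
  moreover have "expectation (\<lambda>\<omega>. (norm (x (Suc n + 1) \<omega> - xs))\<^sup>2) \<le> ?q ^ Suc n * (norm (x1 - xs))\<^sup>2 + ?b"
  proof -
    have "1 \<le> d" unfolding d_def by (simp add: Suc_leI)
    then have "\<gamma> * \<mu> \<le> 1 / 5"
    proof -
      have "\<gamma> * \<mu> \<le> \<gamma> * (d * L)"
        using \<gamma> \<mu>_L \<open>1 \<le> d\<close> mult_mono[of 1 d \<mu> L] by (intro mult_left_mono) auto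
      also have "\<dots> \<le> 1 / 5" using \<gamma> \<mu>_L \<open>1 \<le> d\<close> by (simp add: field_simps)
      finally show ?thesis .
    qed
    then have q: "0 \<le> ?q" by simp
    have "expectation (\<lambda>\<omega>. (norm (x (Suc n + 1) \<omega> - xs))\<^sup>2) = expectation (\<lambda>\<omega>. (norm (?x' \<omega> - xs))\<^sup>2)"
      by (rule Bochner_Integration.integral_cong) (use x' in simp_all)
    also have "\<dots> \<le> ?q * (?q ^ n * (norm (x1 - xs))\<^sup>2 + ?b) + 4 * \<gamma>\<^sup>2 * d\<^sup>2 * \<sigma>\<^sup>2"
      using bound mult_left_mono[OF IH(3) q] by linarith
    also have "\<dots> = ?q ^ Suc n * (norm (x1 - xs))\<^sup>2 + (?q * ?b + 4 * \<gamma>\<^sup>2 * d\<^sup>2 * \<sigma>\<^sup>2)"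
      by (simp add: distrib_left mult.assoc)
    also have "?q * ?b + 4 * \<gamma>\<^sup>2 * d\<^sup>2 * \<sigma>\<^sup>2 = ?b"
      using \<mu>_L by (simp add: field_simps power2_eq_square)
    finally show ?thesis .
  qed
  ultimately show ?case using meas by blast
qed

section \<open>The tuned step size\<close>

text \<open>
  By \<open>1 - s \<le> exp (- s)\<close> the first term decays like \<open>exp (- \<gamma> \<mu> K / 2)\<close>. If the minimum defining \<open>\<gamma>\<close> is
  \<open>1 / (5 d L)\<close>, this is even the square of the exponential in the claim. Otherwise \<open>\<gamma> \<mu> K / 2 = l\<close>, and
  \<open>exp l\<close> is at least \<open>D / T\<close>, so the first term is at most \<open>T\<close>. In both cases the second term is at most
  \<open>l T\<close>, because \<open>\<gamma>\<close> is at most the second entry of the minimum. The cut-off at 2 inside the logarithm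
  yields \<open>l \<ge> 1/2\<close>, so \<open>T + l T \<le> 3 l T\<close>.
\<close>

lemma tuned_step_size_bound:
  fixes \<mu> L d \<sigma> \<gamma> D :: real and K :: nat
  defines "T \<equiv> 20 * d\<^sup>2 * \<sigma>\<^sup>2 / (\<mu>\<^sup>2 * real K)"
    and "l \<equiv> ln (max 2 (\<mu>\<^sup>2 * D * real K / (20 * d\<^sup>2 * \<sigma>\<^sup>2)))"
  assumes pos: "0 < \<mu>" "\<mu> \<le> L" "1 \<le> d" "0 < \<sigma>" "1 \<le> K" and D: "0 \<le> D"
    and \<gamma>: "0 < \<gamma>" "\<gamma> \<le> 1 / (5 * d * L)" "\<gamma> = min (1 / (5 * d * L)) (2 * l / (\<mu> * real K))"
  shows "(1 - \<gamma> * \<mu> / 2) ^ K * D + 10 * d\<^sup>2 * \<gamma> * \<sigma>\<^sup>2 / \<mu>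
    \<le> soft_O_const * (exp (- (\<mu> * real K / (20 * d * L))) * D + l * T)"
proof -
  let ?m = "max 2 (\<mu>\<^sup>2 * D * real K / (20 * d\<^sup>2 * \<sigma>\<^sup>2))"
  have T: "0 < T" unfolding T_def using pos by simp
  have "exp (1 / 2) \<le> (2::real)"
  proof -
    have "exp (1 / 2 :: real) ^ 2 = exp 1" using exp_double[of "1 / 2 :: real"] by simp
    then have "exp (1 / 2 :: real) ^ 2 \<le> 2 ^ 2" using exp_le by simp
    then show ?thesis by (rule power2_le_imp_le) simp
  qed
  then have "1 / 2 \<le> ln (2::real)" using ln_ge_iff[of 2 "1 / 2"] by simp
  also have "\<dots> \<le> l" unfolding l_def by simp
  finally have l: "1 \<le> 2 * l" by simp
  have "\<gamma> * \<mu> \<le> 1 / 5"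
  proof -
    have "\<gamma> * \<mu> \<le> \<gamma> * (d * L)"
      using \<gamma>(1) pos mult_mono[of 1 d \<mu> L] by (intro mult_left_mono) auto
    also have "\<dots> \<le> 1 / 5" using \<gamma>(2) pos by (simp add: field_simps)
    finally show ?thesis .
  qed
  then have "(1 - \<gamma> * \<mu> / 2) ^ K \<le> exp (- (\<gamma> * \<mu> / 2)) ^ K"
    using exp_ge_add_one_self[of "- (\<gamma> * \<mu> / 2)"] by (intro power_mono) auto
  also have "\<dots> = exp (- (\<gamma> * \<mu> * real K / 2))"
    by (simp add: exp_of_nat_mult[symmetric] mult_ac)
  finally have contraction: "(1 - \<gamma> * \<mu> / 2) ^ K * D \<le> exp (- (\<gamma> * \<mu> * real K / 2)) * D"
    using D by (rule mult_right_mono)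
  have "exp (- (\<gamma> * \<mu> * real K / 2)) * D \<le> exp (- (\<mu> * real K / (20 * d * L))) * D + T"
  proof (cases "1 / (5 * d * L) \<le> 2 * l / (\<mu> * real K)")
    case True
    then have "\<gamma> = 1 / (5 * d * L)" using \<gamma>(3) by simp
    then have "\<gamma> * \<mu> * real K / 2 = 2 * (\<mu> * real K / (20 * d * L))" by simp
    moreover have "0 \<le> \<mu> * real K / (20 * d * L)" using pos by simp
    ultimately have "exp (- (\<gamma> * \<mu> * real K / 2)) \<le> exp (- (\<mu> * real K / (20 * d * L)))"
      unfolding exp_le_cancel_iff neg_le_iff_le by linarith
    then have "exp (- (\<gamma> * \<mu> * real K / 2)) * D \<le> exp (- (\<mu> * real K / (20 * d * L))) * D"
      using D by (rule mult_right_mono)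
    then show ?thesis using T by linarith
  next
    case False
    then have "\<gamma> = 2 * l / (\<mu> * real K)" using \<gamma>(3) by simp
    then have "\<gamma> * \<mu> * real K / 2 = l" using pos by simp
    moreover have "exp l = ?m" unfolding l_def by (intro exp_ln) (simp only: less_max_iff_disj zero_less_numeral simp_thms)
    ultimately have "exp (- (\<gamma> * \<mu> * real K / 2)) * D = D / ?m"
      by (simp only: exp_minus divide_inverse mult.commute[of D])
    also have "\<dots> \<le> T"
    proof -
      have "\<mu>\<^sup>2 * D * real K / (20 * d\<^sup>2 * \<sigma>\<^sup>2) \<le> ?m" by simp
      moreover have "\<mu>\<^sup>2 * D * real K / (20 * d\<^sup>2 * \<sigma>\<^sup>2) = D / T"
        unfolding T_def by (simp only: divide_divide_eq_right mult_ac)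
      ultimately have "D / T \<le> ?m" by (simp only:)
      then have "D \<le> ?m * T" using T by (simp only: pos_divide_le_eq)
      moreover have "0 < ?m" by (simp only: less_max_iff_disj zero_less_numeral simp_thms)
      ultimately show ?thesis by (simp only: pos_divide_le_eq mult.commute[of T])
    qed
    finally have "exp (- (\<gamma> * \<mu> * real K / 2)) * D \<le> T" .
    moreover have "0 \<le> exp (- (\<mu> * real K / (20 * d * L))) * D" using D by simp
    ultimately show ?thesis by linarith
  qed
  moreover have "10 * d\<^sup>2 * \<gamma> * \<sigma>\<^sup>2 / \<mu> \<le> l * T"
  proof -
    have "10 * d\<^sup>2 * \<gamma> * \<sigma>\<^sup>2 / \<mu> = (10 * d\<^sup>2 * \<sigma>\<^sup>2 / \<mu>) * \<gamma>" by simp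
    also have "\<dots> \<le> (10 * d\<^sup>2 * \<sigma>\<^sup>2 / \<mu>) * (2 * l / (\<mu> * real K))"
      using \<gamma>(3) pos by (intro mult_left_mono) auto
    also have "\<dots> = l * T" unfolding T_def by (simp add: power2_eq_square mult_ac)
    finally show ?thesis .
  qed
  moreover have "T \<le> 2 * (l * T)" using mult_right_mono[OF l, of T] T by simp
  moreover have "0 \<le> exp (- (\<mu> * real K / (20 * d * L))) * D" using D by simp
  ultimately show ?thesis using contraction unfolding soft_O_const_def distrib_left by linarith
qed

theorem corollary3:
  fixes A :: "real^'n^'n" and xs x1 :: "real^'n"
    and \<mu> L \<sigma> \<gamma> d :: real and \<tau> :: "nat \<Rightarrow> real" and K :: nat
    and M :: "'w measure"
    and e x :: "nat \<Rightarrow> 'w \<Rightarrow> real^'n" and \<xi>p \<xi>m :: "nat \<Rightarrow> 'w \<Rightarrow> real"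
  assumes d_def: "d = real CARD('n)"
    and \<mu>_L: "0 < \<mu>" "\<mu> \<le> L"
    and A: "transpose A = A" "positive_definite A" "\<And>l. eigenvalue A l \<Longrightarrow> \<mu> \<le> l \<and> l \<le> L"
    and K: "1 \<le> K"
    and \<sigma>: "0 \<le> \<sigma>"
    and \<gamma>: "0 < \<gamma>" "\<gamma> \<le> 1 / (5 * d * L)"
    and \<tau>: "\<And>k. k \<in> {1..K} \<Longrightarrow> 0 < \<tau> k \<and> sqrt (2 * d * \<sigma>\<^sup>2 / (\<mu> * L)) \<le> \<tau> k"
    and M: "prob_space M"
    and e: "\<And>k. k \<in> {1..K} \<Longrightarrow> e k \<in> borel_measurable M \<and> distr M borel (e k) = uniform_sphere"
    and \<xi>: "\<And>k. k \<in> {1..K} \<Longrightarrow> admissible_noise M \<sigma> (\<xi>p k) \<and> admissible_noise M \<sigma> (\<xi>m k)"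
    and indep: "\<And>k. k \<in> {1..K} \<Longrightarrow> independent_draws M e \<xi>p \<xi>m k"
    and start: "\<And>\<omega>. \<omega> \<in> space M \<Longrightarrow> x 1 \<omega> = x1"
    and step: "\<And>k \<omega>. k \<in> {1..K} \<Longrightarrow> \<omega> \<in> space M \<Longrightarrow>
      x (k + 1) \<omega> = x k \<omega> -
        \<gamma> *\<^sub>R grad_estimate (noisy_oracle A xs) (x k \<omega>) (\<xi>p k \<omega>) (\<xi>m k \<omega>) (\<tau> k) (e k \<omega>)"
  shows "integrable M (\<lambda>\<omega>. (norm (x (K + 1) \<omega> - xs))\<^sup>2) \<and>
    (\<integral>\<omega>. (norm (x (K + 1) \<omega> - xs))\<^sup>2 \<partial>M)
      \<le> (1 - \<gamma> * \<mu> / 2) ^ K * (norm (x1 - xs))\<^sup>2 + 10 * d\<^sup>2 * \<gamma> * \<sigma>\<^sup>2 / \<mu> \<and>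
    (0 < \<sigma> \<longrightarrow>
     \<gamma> = min (1 / (5 * d * L))
       (2 * ln (max 2 (\<mu>\<^sup>2 * (norm (x1 - xs))\<^sup>2 * real K / (20 * d\<^sup>2 * \<sigma>\<^sup>2))) / (\<mu> * real K)) \<longrightarrow>
     (\<integral>\<omega>. (norm (x (K + 1) \<omega> - xs))\<^sup>2 \<partial>M)
      \<le> soft_O_const * (exp (- (\<mu> * real K / (20 * d * L))) * (norm (x1 - xs))\<^sup>2 +
          ln (max 2 (\<mu>\<^sup>2 * (norm (x1 - xs))\<^sup>2 * real K / (20 * d\<^sup>2 * \<sigma>\<^sup>2))) *
          (20 * d\<^sup>2 * \<sigma>\<^sup>2 / (\<mu>\<^sup>2 * real K))))"
proof -
  let ?E = "\<integral>\<omega>. (norm (x (K + 1) \<omega> - xs))\<^sup>2 \<partial>M"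
  let ?D = "(norm (x1 - xs))\<^sup>2"
  have "x (K + 1) \<in> borel_measurable (history M e \<xi>p \<xi>m (K + 1)) \<and>
      integrable M (\<lambda>\<omega>. (norm (x (K + 1) \<omega> - xs))\<^sup>2) \<and>
      ?E \<le> (1 - \<gamma> * \<mu> / 2) ^ K * ?D + 8 * d\<^sup>2 * \<gamma> * \<sigma>\<^sup>2 / \<mu>"
    by (rule zoGD_constant_step[where K=K and A=A and L=L and \<tau>=\<tau>])
      (fact assms order_refl)+
  then have main: "integrable M (\<lambda>\<omega>. (norm (x (K + 1) \<omega> - xs))\<^sup>2)"
    "?E \<le> (1 - \<gamma> * \<mu> / 2) ^ K * ?D + 8 * d\<^sup>2 * \<gamma> * \<sigma>\<^sup>2 / \<mu>"
    by auto
  have "8 * d\<^sup>2 * \<gamma> * \<sigma>\<^sup>2 / \<mu> \<le> 10 * d\<^sup>2 * \<gamma> * \<sigma>\<^sup>2 / \<mu>"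
    using \<gamma>(1) \<mu>_L(1) by (intro divide_right_mono mult_right_mono) auto
  with main(2) have bound: "?E \<le> (1 - \<gamma> * \<mu> / 2) ^ K * ?D + 10 * d\<^sup>2 * \<gamma> * \<sigma>\<^sup>2 / \<mu>"
    by linarith
  have "1 \<le> d" unfolding d_def by (simp add: Suc_leI)
  note tuned = tuned_step_size_bound[OF \<mu>_L \<open>1 \<le> d\<close> _ K zero_le_power2 \<gamma>]
  show ?thesis
  proof (intro conjI impI)
    show "integrable M (\<lambda>\<omega>. (norm (x (K + 1) \<omega> - xs))\<^sup>2)" by (rule main(1))
    show "?E \<le> (1 - \<gamma> * \<mu> / 2) ^ K * ?D + 10 * d\<^sup>2 * \<gamma> * \<sigma>\<^sup>2 / \<mu>" by (rule bound)
  next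
    let ?l = "ln (max 2 (\<mu>\<^sup>2 * ?D * real K / (20 * d\<^sup>2 * \<sigma>\<^sup>2)))"
    assume "0 < \<sigma>" and "\<gamma> = min (1 / (5 * d * L)) (2 * ?l / (\<mu> * real K))"
    then show "?E \<le> soft_O_const * (exp (- (\<mu> * real K / (20 * d * L))) * ?D +
        ?l * (20 * d\<^sup>2 * \<sigma>\<^sup>2 / (\<mu>\<^sup>2 * real K)))"
      by (rule order_trans[OF bound tuned])
  qed
qed

end
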